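(* Let $q\in F^*$ be a root of unity of order $N$ with $q\neq\pm1$ and $q^3\neq1$, and let $\dim V=2$ with braiding of Cartan type $G_2$: $q_{11}=q$, $q_{12}q_{21}=q^{-3}$, $q_{22}=q^3$. Then $\dim\mathfrak{L}(V)=N^6-1$ if $3\nmid N$, and $\dim\mathfrak{L}(V)=(N/3)^3N^3-1$ if $3\mid N$.
   Context: $F$ is an algebraically closed field of characteristic $0$. $V$ is a braided vector space of diagonal type with basis $x_1,x_2$ and braiding $C(x_i\otimes x_j)=q_{ij}x_j\otimes x_i$; $\mathfrak{B}(V)$ is its Nichols algebra, $\mathbb{Z}^2$-graded with $\deg x_i=e_i$, $\chi(e_i,e_j)=q_{ij}$ and $p_{uv}:=\chi(\deg u,\deg v)$ for homogeneous $u,v$. For homogeneous $x,y$, $[x,y]:=yx-p_{yx}xy$, and $\mathfrak{L}(V)$ is the linear span in $\mathfrak{B}(V)$ of all iterated brackets (any bracketing) of $x_1,x_2$. *)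

theory Defs
  imports Main "HOL-Computational_Algebra.Polynomial"
begin

text \<open>Tensor algebra T(V) of V = span(x1, x2): elements are coefficient functions on words;
  letter False stands for x1, letter True for x2.  A braiding matrix of diagonal type is
  qm :: bool => bool => 'a, with qm i j = q_ij.\<close>

type_synonym 'a tens = "bool list \<Rightarrow> 'a"

definition tadd :: "'a::field tens \<Rightarrow> 'a tens \<Rightarrow> 'a tens" where
  "tadd f g = (\<lambda>w. f w + g w)"

definition tsub :: "'a::field tens \<Rightarrow> 'a tens \<Rightarrow> 'a tens" where
  "tsub f g = (\<lambda>w. f w - g w)"

definition tscale :: "'a::field \<Rightarrow> 'a tens \<Rightarrow> 'a tens" where
  "tscale c f = (\<lambda>w. c * f w)"

definition tmult :: "'a::field tens \<Rightarrow> 'a tens \<Rightarrow> 'a tens" where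
  "tmult f g = (\<lambda>w. \<Sum>k\<le>length w. f (take k w) * g (drop k w))"

definition tword :: "bool list \<Rightarrow> 'a::field tens" where
  "tword u = (\<lambda>w. if w = u then 1 else 0)"

definition chiw :: "(bool \<Rightarrow> bool \<Rightarrow> 'a::field) \<Rightarrow> bool list \<Rightarrow> bool list \<Rightarrow> 'a" where
  "chiw qm u v = (\<Prod>a\<leftarrow>u. \<Prod>b\<leftarrow>v. qm a b)"

text \<open>Skew derivation d_i determined by Delta(u) = ... + sum_i d_i(u) (x) x_i, i.e.
  d_i(x_j) = delta_ij and d_i(uv) = u d_i(v) + chi(e_i, deg v) d_i(u) v.\<close>
definition skder :: "(bool \<Rightarrow> bool \<Rightarrow> 'a::field) \<Rightarrow> bool \<Rightarrow> 'a tens \<Rightarrow> 'a tens" where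
  "skder qm i f = (\<lambda>w. \<Sum>k\<le>length w. chiw qm [i] (drop k w) * f (take k w @ [i] @ drop k w))"

fun skders :: "(bool \<Rightarrow> bool \<Rightarrow> 'a::field) \<Rightarrow> bool list \<Rightarrow> 'a tens \<Rightarrow> 'a tens" where
  "skders qm [] f = f"
| "skders qm (i # is) f = skder qm i (skders qm is f)"

text \<open>The defining ideal of the Nichols algebra: B(V) = T(V)/I.  An element lies in I iff all
  full iterated skew derivations of all its homogeneous components vanish.\<close>
definition nichols_ideal :: "(bool \<Rightarrow> bool \<Rightarrow> 'a::field) \<Rightarrow> 'a tens \<Rightarrow> bool" where
  "nichols_ideal qm f \<longleftrightarrow> (\<forall>is. skders qm is f [] = 0)"

datatype brk = Gen bool | Brk brk brk

fun leaves :: "brk \<Rightarrow> bool list" where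
  "leaves (Gen b) = [b]"
| "leaves (Brk s t) = leaves s @ leaves t"

fun brk_eval :: "(bool \<Rightarrow> bool \<Rightarrow> 'a::field) \<Rightarrow> brk \<Rightarrow> 'a tens" where
  "brk_eval qm (Gen b) = tword [b]"
| "brk_eval qm (Brk s t) =
     tsub (tmult (brk_eval qm t) (brk_eval qm s))
          (tscale (chiw qm (leaves t) (leaves s)) (tmult (brk_eval qm s) (brk_eval qm t)))"

text \<open>dim L(V) = k: L(V) (the span of the images of all iterated brackets in B(V)) has a basis
  of k elements (chosen among the bracket images).\<close>
definition dim_L :: "(bool \<Rightarrow> bool \<Rightarrow> 'a::field) \<Rightarrow> nat \<Rightarrow> bool" where
  "dim_L qm k \<longleftrightarrow> (\<exists>B. finite B \<and> card B = k
     \<and> (\<forall>c. nichols_ideal qm (\<lambda>w. \<Sum>t\<in>B. c t * brk_eval qm t w) \<longrightarrow> (\<forall>t\<in>B. c t = 0))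
     \<and> (\<forall>s. \<exists>c. nichols_ideal qm (\<lambda>w. brk_eval qm s w - (\<Sum>t\<in>B. c t * brk_eval qm t w))))"

definition alg_closed_field :: "'a::field itself \<Rightarrow> bool" where
  "alg_closed_field _ \<longleftrightarrow> (\<forall>p :: 'a poly. degree p > 0 \<longrightarrow> (\<exists>x. poly p x = 0))"

end

theory Submission
  imports Defs
begin

text \<open>
  An element lies in the Nichols ideal iff its constant term vanishes and both skew derivatives
  lie in the ideal, so relations are checked by differentiating. Besides \<open>x\<^sub>1, x\<^sub>2\<close> there are root
  vectors z, v, u, w of degrees \<open>\<alpha>\<^sub>1 + \<alpha>\<^sub>2\<close>, \<open>2\<alpha>\<^sub>1 + \<alpha>\<^sub>2\<close>, \<open>3\<alpha>\<^sub>1 + \<alpha>\<^sub>2\<close>, \<open>3\<alpha>\<^sub>1 + 2\<alpha>\<^sub>2\<close>, all killed by the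
  derivation of \<open>x\<^sub>2\<close>. Six q-commutation relations and the vanishing powers of the six root vectors
  have lexicographically smallest words such that a word avoiding all of them is a product of bounded
  powers of the six Lyndon words; this bounds the dimension from above. Conversely, the PBW monomials are
  independent: successive skew derivations, each defined on the kernel of the previous one, strip
  off the root vectors one at a time.

  Brackets span every positive degree. If words a, b are in the span and
  \<open>\<chi>(a,b)\<chi>(b,a) \<noteq> 1\<close>, then so is ab, and membership of ab is invariant under rotation. Splitting off
  a single letter fails only in degrees congruent to the sum of the positive roots; there one splits
  off \<open>x\<^sub>1x\<^sub>2\<close>, or \<open>x\<^sub>1x\<^sub>2x\<^sub>1\<close> when \<open>q\<^sup>6 = 1\<close>.
\<close>

section \<open>Noncommutative power series and skew derivations\<close>

text \<open>The value \<chi>(b,b) of a positive root b is \<open>q\<close> for the three short roots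
  and \<open>q ^ 3\<close> for the three long ones. So the root vectors have heights
  \<open>N\<close> and \<open>M\<close>, the orders of \<open>q\<close> and \<open>q ^ 3\<close>,
  both bounds count M^3 N^3 monomials, and dropping the unit gives the dimension. Only the product
  of the two off-diagonal entries is prescribed, so one of them stays a free unit, which cancels in
  every \<chi>(a,b)\<chi>(b,a). The obstacle to independence is that a composite of skew derivations
  is not skew: expanding D(d(ab)) leaves the cross terms D(a) \<tau>(d(b)) and d(a) D(\<sigma>(b)).
  They vanish only on elements that D already kills, which dictates the chain of domains. The
  exceptional degrees in the spanning argument come from the identity (2\<rho>, a) = (a, a) for a
  simple root a, where 2\<rho> is the sum of the positive roots: once a letter is removed, its
  pairing with the remaining word is 1, for either letter.\<close>

text \<open>The quotient by the Nichols ideal depends on the braiding and so cannot be a type; all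
  computations are carried out in this ring, modulo the ideal.\<close>
typedef 'a ncser = "UNIV :: (bool list \<Rightarrow> 'a) set"
  morphisms cf NC by simp

lemma cf_NC [simp]: "cf (NC f) = f"
  by (simp add: NC_inverse)

lemma ncser_eqI: "(\<And>w. cf f w = cf g w) \<Longrightarrow> f = g"
  by (metis cf_inject ext)

lemma tmult_Nil [simp]: "tmult f g [] = f [] * g []"
  by (simp add: tmult_def)

text \<open>Splitting off the summand \<open>k = 0\<close> turns the convolution into a recursion on
  the word; associativity and the skew Leibniz rule then follow by induction on the word of
  evaluation.\<close>

lemma tmult_Cons: "tmult f g (x # w) = f [] * g (x # w) + tmult (\<lambda>u. f (x # u)) g w"
  by (simp add: tmult_def sum.atMost_Suc_shift del: sum.atMost_Suc)

lemma tmult_add_left: "tmult (\<lambda>u. f u + g u) h w = tmult f h w + tmult g h w"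
  by (simp add: tmult_def distrib_right sum.distrib)

lemma tmult_add_right: "tmult f (\<lambda>u. g u + h u) w = tmult f g w + tmult f h w"
  by (simp add: tmult_def distrib_left sum.distrib)

lemma tmult_scale_left: "tmult (\<lambda>u. c * f u) h w = c * tmult f h w"
  by (simp add: tmult_def sum_distrib_left ac_simps)

lemma tmult_scale_right: "tmult f (\<lambda>u. c * h u) w = c * tmult f h w"
  by (simp add: tmult_def sum_distrib_left ac_simps)

lemma tmult_tword_Nil_left: "tmult (tword []) f w = f w"
proof (cases w)
  case (Cons x w')
  have "tmult (\<lambda>u. tword [] (x # u)) f w' = 0"
    by (simp add: tmult_def tword_def)
  then show ?thesis
    by (simp add: Cons tmult_Cons) (simp add: tword_def)
qed (simp add: tword_def)

lemma tmult_tword_Nil_right: "tmult f (tword []) w = f w"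
  by (induction w arbitrary: f) (auto simp: tmult_Cons, auto simp: tword_def)

lemma tmult_assoc: "tmult (tmult f g) h w = tmult f (tmult g h) w"
proof (induction w arbitrary: f)
  case (Cons x w)
  have "tmult (\<lambda>u. tmult f g (x # u)) h w
      = f [] * tmult (\<lambda>u. g (x # u)) h w + tmult (\<lambda>u. f (x # u)) (tmult g h) w"
    by (simp add: tmult_Cons tmult_add_left tmult_scale_left Cons.IH)
  then show ?case
    by (simp add: tmult_Cons algebra_simps)
qed simp

instantiation ncser :: (field) ring_1
begin

definition "0 = NC (\<lambda>_. 0)"
definition "1 = NC (tword [])"
definition "f + g = NC (tadd (cf f) (cf g))"
definition "f - g = NC (tsub (cf f) (cf g))"
definition "- f = NC (\<lambda>w. - cf f w)"
definition "f * g = NC (tmult (cf f) (cf g))"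

instance
proof
  fix a b c :: "'a ncser"
  show "a + b + c = a + (b + c)" "a + b = b + a" "0 + a = a" "- a + a = 0" "a - b = a + - b"
    by (simp_all add: zero_ncser_def plus_ncser_def minus_ncser_def uminus_ncser_def tadd_def
        tsub_def ac_simps ncser_eqI)
  show "a * b * c = a * (b * c)"
    by (rule ncser_eqI) (simp add: times_ncser_def tmult_assoc)
  show "1 * a = a" "a * 1 = a"
    by (auto intro!: ncser_eqI simp: one_ncser_def times_ncser_def tmult_tword_Nil_left
        tmult_tword_Nil_right)
  show "(a + b) * c = a * c + b * c" "a * (b + c) = a * b + a * c"
    by (auto intro!: ncser_eqI simp: plus_ncser_def times_ncser_def tadd_def tmult_add_left
        tmult_add_right)
  have "cf (0::'a ncser) [] \<noteq> cf 1 []"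
    by (simp add: zero_ncser_def one_ncser_def tword_def)
  then show "(0::'a ncser) \<noteq> 1"
    by metis
qed

end

definition scl :: "'a::field \<Rightarrow> 'a ncser \<Rightarrow> 'a ncser" where
  "scl c f = NC (tscale c (cf f))"

lemma cf_simps [simp]:
  "cf 0 w = 0" "cf 1 w = (if w = [] then 1 else 0)" "cf (f + g) w = cf f w + cf g w"
  "cf (f - g) w = cf f w - cf g w" "cf (- f) w = - cf f w" "cf (scl c f) w = c * cf f w"
  by (simp_all add: zero_ncser_def one_ncser_def plus_ncser_def minus_ncser_def uminus_ncser_def
      tadd_def tsub_def tscale_def scl_def tword_def)

lemma cf_mult: "cf (f * g) = tmult (cf f) (cf g)"
  by (simp add: times_ncser_def)

lemma cf_mult_Nil [simp]: "cf (f * g) [] = cf f [] * cf g []"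
  by (simp add: cf_mult)

lemma cf_sum [simp]: "cf (sum f A) w = (\<Sum>x\<in>A. cf (f x) w)"
  by (induction A rule: infinite_finite_induct) auto

lemma scl_mult_left [simp]: "scl c f * g = scl c (f * g)"
  by (rule ncser_eqI) (simp add: cf_mult scl_def tscale_def tmult_scale_left)

lemma scl_mult_right [simp]: "f * scl c g = scl c (f * g)"
  by (rule ncser_eqI) (simp add: cf_mult scl_def tscale_def tmult_scale_right)

lemma scl_scl [simp]: "scl c (scl d f) = scl (c * d) f"
  by (rule ncser_eqI) simp

lemma scl_0 [simp]: "scl 0 f = 0" "scl c 0 = 0"
  by (auto intro: ncser_eqI)

lemma scl_1 [simp]: "scl 1 f = f"
  by (auto intro: ncser_eqI)

lemma scl_add: "scl c (f + g) = scl c f + scl c g"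
  by (auto intro!: ncser_eqI simp: algebra_simps)

lemma scl_diff: "scl c (f - g) = scl c f - scl c g"
  by (auto intro!: ncser_eqI simp: algebra_simps)

lemma scl_minus: "scl c (- f) = - scl c f"
  by (auto intro!: ncser_eqI simp: algebra_simps)

lemma scl_add_left: "scl (c + d) f = scl c f + scl d f"
  by (auto intro!: ncser_eqI simp: algebra_simps)

lemma scl_diff_left: "scl (c - d) f = scl c f - scl d f"
  by (auto intro!: ncser_eqI simp: algebra_simps)

lemmas scl_distribs = scl_add scl_diff scl_minus

definition wd :: "bool list \<Rightarrow> 'a::field ncser" where
  "wd u = NC (tword u)"

lemma cf_wd: "cf (wd u) w = (if w = u then 1 else 0)"
  by (simp add: wd_def tword_def)

lemma wd_Nil: "wd [] = 1"
  by (simp add: wd_def one_ncser_def)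

lemma tword_Cons_Nil: "tword (a # u) [] = 0"
  by (simp add: tword_def)

lemma tmult_tword: "tmult (tword u) (tword v) w = (tword (u @ v) w :: 'a::field)"
proof (induction u arbitrary: w)
  case Nil
  then show ?case
    by (simp add: tmult_tword_Nil_left)
next
  case (Cons a u)
  show ?case
  proof (cases w)
    case Nil
    then show ?thesis
      by (simp add: tword_def)
  next
    case (Cons b w')
    have *: "tword (a # u) (b # x) = ((if a = b then 1 else 0) * tword u x :: 'a)" for x
      by (simp add: tword_def)
    have "tmult (tword (a # u)) (tword v) w = ((if a = b then 1 else 0) * tmult (tword u) (tword v) w' :: 'a)"
      by (simp only: Cons tmult_Cons * tmult_scale_left) (simp add: tword_Cons_Nil)
    also have "\<dots> = tword ((a # u) @ v) w"
      by (simp only: Cons.IH Cons) (simp add: tword_def)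
    finally show ?thesis .
  qed
qed

lemma wd_append: "wd (u @ v) = wd u * wd v"
  by (rule ncser_eqI) (simp add: cf_mult, simp add: wd_def tmult_tword)

lemma wd_Cons: "wd (a # u) = wd [a] * wd u"
  using wd_append[of "[a]" u] by simp

section \<open>Skew derivations of a diagonal braiding\<close>

locale braiding =
  fixes qm :: "bool \<Rightarrow> bool \<Rightarrow> 'a::field"
begin

definition sd :: "bool \<Rightarrow> 'a ncser \<Rightarrow> 'a ncser" where
  "sd i f = NC (skder qm i (cf f))"

text \<open>The diagonal automorphism that twists the Leibniz rule of \<open>sd i\<close>.\<close>

definition tw :: "bool \<Rightarrow> 'a ncser \<Rightarrow> 'a ncser" where
  "tw i f = NC (\<lambda>w. chiw qm [i] w * cf f w)"

definition nid :: "'a ncser set" where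
  "nid = {f. nichols_ideal qm (cf f)}"

lemma chiw_Nil [simp]: "chiw qm [] w = 1" "chiw qm w [] = 1"
  by (simp_all add: chiw_def) (induction w, auto)

lemma chiw_append_left: "chiw qm (u @ v) w = chiw qm u w * chiw qm v w"
  by (simp add: chiw_def)

lemma chiw_append_right: "chiw qm w (u @ v) = chiw qm w u * chiw qm w v"
  by (induction w) (auto simp: chiw_def)

lemma chiw_single [simp]: "chiw qm [i] [j] = qm i j"
  by (simp add: chiw_def)

lemma chiw_Cons_right: "chiw qm w (j # v) = chiw qm w [j] * chiw qm w v"
  using chiw_append_right[of w "[j]" v] by simp

lemma chiw_Cons_left: "chiw qm (j # v) w = chiw qm [j] w * chiw qm v w"
  using chiw_append_left[of "[j]" v w] by simp

lemma sd_linear [simp]: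
  "sd i (f + g) = sd i f + sd i g" "sd i (f - g) = sd i f - sd i g" "sd i (- f) = - sd i f"
  "sd i (scl c f) = scl c (sd i f)" "sd i 0 = 0"
  by (auto intro!: ncser_eqI simp: sd_def skder_def algebra_simps sum.distrib sum_subtractf
      sum_negf sum_distrib_left)

lemma sd_1 [simp]: "sd i 1 = 0"
  by (auto intro!: ncser_eqI sum.neutral simp: sd_def skder_def)

lemma tw_linear [simp]:
  "tw i (f + g) = tw i f + tw i g" "tw i (f - g) = tw i f - tw i g" "tw i (- f) = - tw i f"
  "tw i (scl c f) = scl c (tw i f)" "tw i 0 = 0" "tw i 1 = 1"
  by (auto intro!: ncser_eqI simp: tw_def algebra_simps)

lemma tmult_chiw:
  "tmult (\<lambda>u. chiw qm [i] u * f u) (\<lambda>u. chiw qm [i] u * g u) w = chiw qm [i] w * tmult f g w"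
  unfolding tmult_def sum_distrib_left
proof (rule sum.cong)
  fix k
  have "chiw qm [i] w = chiw qm [i] (take k w) * chiw qm [i] (drop k w)"
    using chiw_append_right[of "[i]" "take k w" "drop k w"] by simp
  then show "chiw qm [i] (take k w) * f (take k w) * (chiw qm [i] (drop k w) * g (drop k w))
      = chiw qm [i] w * (f (take k w) * g (drop k w))"
    by simp
qed simp

lemma tw_mult [simp]: "tw i (f * g) = tw i f * tw i g"
  by (rule ncser_eqI) (simp add: tw_def cf_mult tmult_chiw)

lemma tw_power [simp]: "tw i (f ^ n) = tw i f ^ n"
  by (induction n) auto

lemma skder_Cons: "skder qm i f (x # w)
    = chiw qm [i] (x # w) * f (i # x # w) + skder qm i (\<lambda>u. f (x # u)) w"
  by (simp add: skder_def sum.atMost_Suc_shift del: sum.atMost_Suc)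

lemma skder_Nil [simp]: "skder qm i f [] = f [i]"
  by (simp add: skder_def)

lemma skder_add: "skder qm i (\<lambda>u. f u + g u) w = skder qm i f w + skder qm i g w"
  by (simp add: skder_def distrib_left sum.distrib)

lemma skder_scale: "skder qm i (\<lambda>u. c * f u) w = c * skder qm i f w"
  by (simp add: skder_def sum_distrib_left ac_simps)

lemma skder_tmult: "skder qm i (tmult f g) w
    = tmult f (skder qm i g) w + tmult (skder qm i f) (\<lambda>u. chiw qm [i] u * g u) w"
proof (induction w arbitrary: f)
  case Nil
  show ?case
    by (simp add: tmult_Cons)
next
  case (Cons x w)
  let ?L = "\<lambda>x f u. f (x # u)"
  have 1: "skder qm i (\<lambda>u. tmult f g (x # u)) w
     = f [] * skder qm i (?L x g) w + (tmult (?L x f) (skder qm i g) w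
         + tmult (skder qm i (?L x f)) (\<lambda>u. chiw qm [i] u * g u) w)"
    by (simp add: tmult_Cons skder_add skder_scale Cons.IH)
  have "chiw qm [i] (x # w) = qm i x * chiw qm [i] w"
    by (simp add: chiw_Cons_right[of "[i]" x w])
  then have 2: "chiw qm [i] (x # w) * tmult (?L x (?L i f)) g w
     = tmult (\<lambda>u. chiw qm [i] (x # u) * f (i # x # u)) (\<lambda>u. chiw qm [i] u * g u) w"
    using tmult_chiw[of i "?L x (?L i f)" g w]
    by (simp add: chiw_Cons_right[of "[i]" x] tmult_scale_left mult.assoc)
  show ?case
    by (simp only: skder_Cons 1, simp only: tmult_Cons tmult_add_left skder_Nil skder_Cons 2[symmetric])
      (simp add: algebra_simps)
qed

lemma sd_mult: "sd i (f * g) = f * sd i g + sd i f * tw i g"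
  by (rule ncser_eqI) (simp add: sd_def tw_def cf_mult skder_tmult)

lemma sd_wd_single [simp]: "sd i (wd [j]) = (if i = j then 1 else 0)"
proof (rule ncser_eqI)
  fix w :: "bool list"
  have "skder qm i (cf (wd [j])) w = (if i = j \<and> w = [] then 1 else 0)"
    by (cases w) (auto simp: cf_wd skder_def append_eq_Cons_conv intro!: sum.neutral)
  then show "cf (sd i (wd [j])) w = cf (if i = j then 1 else 0) w"
    by (simp add: sd_def)
qed

lemma tw_wd: "tw i (wd w) = scl (chiw qm [i] w) (wd w)"
  by (auto intro!: ncser_eqI simp: tw_def cf_wd)

text \<open>The letter \<open>j\<close> removed by \<open>sd j\<close> had contributed the factor
  \<open>qm i j\<close> to the twist.\<close>

lemma sd_tw: "sd j (tw i f) = scl (qm i j) (tw i (sd j f))"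
proof (rule ncser_eqI)
  fix w
  have "chiw qm [i] (take k w @ [j] @ drop k w) = qm i j * chiw qm [i] w" for k
  proof -
    have "chiw qm [i] (take k w @ [j] @ drop k w)
        = qm i j * (chiw qm [i] (take k w) * chiw qm [i] (drop k w))"
      by (simp add: chiw_append_right chiw_Cons_right[of "[i]" j "drop k w"])
    then show ?thesis
      by (simp flip: chiw_append_right)
  qed
  then show "cf (sd j (tw i f)) w = cf (scl (qm i j) (tw i (sd j f))) w"
    by (simp add: sd_def tw_def skder_def sum_distrib_left ac_simps)
qed

section \<open>The Nichols ideal\<close>

definition sds :: "bool list \<Rightarrow> 'a ncser \<Rightarrow> 'a ncser" where
  "sds js f = NC (skders qm js (cf f))"

lemma sds_Nil [simp]: "sds [] f = f"
  by (simp add: sds_def cf_inverse)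

lemma sds_Cons: "sds (i # js) f = sd i (sds js f)"
  by (simp add: sds_def sd_def)

lemma sds_snoc: "sds (js @ [i]) f = sds js (sd i f)"
  by (induction js) (simp_all add: sds_Cons)

lemma sds_linear:
  "sds js (f + g) = sds js f + sds js g" "sds js (f - g) = sds js f - sds js g"
  "sds js (scl c f) = scl c (sds js f)" "sds js 0 = 0"
  by (induction js) (simp_all add: sds_Cons)

lemma sds_sum: "sds js (sum f A) = (\<Sum>x\<in>A. sds js (f x))"
  by (induction A rule: infinite_finite_induct) (auto simp: sds_linear)

lemma nid_iff_sds: "f \<in> nid \<longleftrightarrow> (\<forall>js. cf (sds js f) [] = 0)"
  by (simp add: nid_def nichols_ideal_def sds_def)

text \<open>In \<open>sds js\<close> the last letter of \<open>js\<close> acts first, so cutting a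
  nonempty word at its end exposes one derivative of \<open>f\<close>.\<close>

lemma nid_iff: "f \<in> nid \<longleftrightarrow> cf f [] = 0 \<and> (\<forall>i. sd i f \<in> nid)"
proof (intro iffI conjI allI)
  assume f: "f \<in> nid"
  show "cf f [] = 0"
    using f nid_iff_sds[of f] sds_Nil by metis
  show "sd i f \<in> nid" for i
    using f unfolding nid_iff_sds by (simp flip: sds_snoc)
next
  assume *: "cf f [] = 0 \<and> (\<forall>i. sd i f \<in> nid)"
  show "f \<in> nid"
    unfolding nid_iff_sds
  proof
    fix js
    show "cf (sds js f) [] = 0"
      using * by (cases js rule: rev_cases) (auto simp: sds_snoc nid_iff_sds)
  qed
qed

lemma nid_sd: "f \<in> nid \<Longrightarrow> sd i f \<in> nid"
  using nid_iff by blast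

lemma nidI: "cf f [] = 0 \<Longrightarrow> sd False f \<in> nid \<Longrightarrow> sd True f \<in> nid \<Longrightarrow> f \<in> nid"
  using nid_iff[of f] by (metis (full_types))

lemma nid_0 [simp]: "0 \<in> nid"
  by (simp add: nid_iff_sds sds_linear)

lemma nid_add: "f \<in> nid \<Longrightarrow> g \<in> nid \<Longrightarrow> f + g \<in> nid"
  and nid_diff: "f \<in> nid \<Longrightarrow> g \<in> nid \<Longrightarrow> f - g \<in> nid"
  and nid_scl: "f \<in> nid \<Longrightarrow> scl c f \<in> nid"
  by (simp_all add: nid_iff_sds sds_linear)

lemma nid_minus: "f \<in> nid \<Longrightarrow> - f \<in> nid"
  using nid_diff[of 0 f] by simp

lemma nid_sum: "(\<And>x. x \<in> A \<Longrightarrow> f x \<in> nid) \<Longrightarrow> sum f A \<in> nid"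
  by (simp add: nid_iff_sds sds_sum)

lemma nid_scl_iff: "c \<noteq> 0 \<Longrightarrow> scl c f \<in> nid \<longleftrightarrow> f \<in> nid"
  using nid_scl[of "scl c f" "inverse c"] nid_scl[of f c] by auto

lemma nid_tw: "f \<in> nid \<Longrightarrow> tw i f \<in> nid"
proof -
  have "f \<in> nid \<Longrightarrow> cf (sds js (tw i f)) [] = 0" for js
  proof (induction js arbitrary: f rule: rev_induct)
    case Nil
    then show ?case
      by (simp add: nid_iff[of f] tw_def)
  next
    case (snoc j js)
    then show ?case
      by (simp add: sds_snoc sd_tw sds_linear nid_sd)
  qed
  then show "f \<in> nid \<Longrightarrow> tw i f \<in> nid"
    by (simp add: nid_iff_sds)
qed

text \<open>The Leibniz rule leaves \<open>f * sd j g\<close> and \<open>sd j f * tw j g\<close>;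
  each again has a factor in the ideal, which is stable under derivations and twists. Hence the
  induction needs \<open>f\<close> and \<open>g\<close> arbitrary.\<close>

lemma nid_mult: "f \<in> nid \<or> g \<in> nid \<Longrightarrow> f * g \<in> nid"
proof -
  have "f \<in> nid \<or> g \<in> nid \<Longrightarrow> cf (sds js (f * g)) [] = 0" for js
  proof (induction js arbitrary: f g rule: rev_induct)
    case Nil
    then show ?case
      by (auto simp: nid_iff[of f] nid_iff[of g])
  next
    case (snoc j js)
    then have "cf (sds js (f * sd j g)) [] = 0" "cf (sds js (sd j f * tw j g)) [] = 0"
      using nid_sd nid_tw by blast+
    then show ?case
      by (simp add: sds_snoc sd_mult sds_linear)
  qed
  then show "f \<in> nid \<or> g \<in> nid \<Longrightarrow> f * g \<in> nid"
    by (simp add: nid_iff_sds)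
qed

lemma nid_mult_left: "f \<in> nid \<Longrightarrow> f * g \<in> nid"
  and nid_mult_right: "g \<in> nid \<Longrightarrow> f * g \<in> nid"
  by (simp_all add: nid_mult)

lemmas nid_closed = nid_add nid_diff nid_minus nid_scl nid_sum nid_mult_left nid_mult_right

lemma nid_cong: "f - g \<in> nid \<Longrightarrow> f \<in> nid \<longleftrightarrow> g \<in> nid"
  using nid_add[of "f - g" g] nid_diff[of f "f - g"] by auto

end

section \<open>Root vectors of type $G_2$\<close>

text \<open>Expansion into scaled, right-nested monomials. Taking \<open>cf\<close> at an arbitrary
  word then makes a noncommutative identity a commutative polynomial one, with the coefficients of
  the monomials as unknowns, to be checked modulo \<open>qt\<close> and \<open>rR\<close>.\<close>

lemmas ncs = distrib_left distrib_right left_diff_distrib right_diff_distrib mult.assoc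
  scl_mult_left scl_mult_right scl_scl scl_add scl_diff minus_mult_left[symmetric]
  minus_mult_right[symmetric] scl_minus mult_1_left mult_1_right

text \<open>Here t and R are the inverses of q and of the free parameter r.\<close>
locale braiding_G2 = braiding qm for qm :: "bool \<Rightarrow> bool \<Rightarrow> 'a::field" +
  fixes q t r R :: 'a
  assumes qm_simps [simp]: "qm False False = q" "qm False True = t ^ 3 * R"
    "qm True False = r" "qm True True = q ^ 3"
    and qt: "q * t = 1" and rR: "r * R = 1"
    and q_ne: "q \<noteq> 1" "q \<noteq> -1" "q ^ 3 \<noteq> 1"
begin

definition "x1 = (wd [False] :: 'a ncser)"
definition "x2 = (wd [True] :: 'a ncser)"
definition "z = x2 * x1 - scl r (x1 * x2)"
definition "v = z * x1 - scl (q * r) (x1 * z)"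
definition "u = v * x1 - scl (q ^ 2 * r) (x1 * v)"
definition "w = v * z - scl (R * t ^ 2) (z * v)"

text \<open>The scalars with which \<open>sd False\<close> lowers \<open>z\<close> to
  \<open>x2\<close>, \<open>v\<close> to \<open>z\<close>, \<open>u\<close> to \<open>v\<close>,
  and, modulo the ideal, \<open>w\<close> to \<open>z * z\<close>.\<close>

definition "cz = 1 - t ^ 3"
definition "cv = (1 + q) * (1 - t ^ 2)"
definition "cu = q ^ 2 - t"
definition "cw = - (R * (1 - t ^ 3) * (1 - t ^ 2))"

lemma sd_x [simp]: "sd False x1 = 1" "sd True x1 = 0" "sd False x2 = 0" "sd True x2 = 1"
  by (simp_all add: x1_def x2_def)

lemma tw_x [simp]: "tw False x1 = scl q x1" "tw True x1 = scl r x1"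
   "tw False x2 = scl (t ^ 3 * R) x2" "tw True x2 = scl (q ^ 3) x2"
  by (simp_all add: x1_def x2_def tw_wd)

lemma sd_True_z [simp]: "sd True z = 0"
  by (simp add: z_def sd_mult)

lemma sd_True_v [simp]: "sd True v = 0"
  by (simp add: v_def sd_mult)

lemma sd_True_u [simp]: "sd True u = 0"
  by (simp add: u_def sd_mult)

lemma sd_True_w [simp]: "sd True w = 0"
  by (simp add: w_def sd_mult)

lemma tw_False_z [simp]: "tw False z = scl (R * t ^ 2) z"
proof (rule ncser_eqI)
  fix a
  show "cf (tw False z) a = cf (scl (R * t ^ 2) z) a"
    unfolding z_def tw_linear tw_mult tw_x ncs cf_simps using qt by algebra
qed

lemma tw_True_z [simp]: "tw True z = scl (r * q ^ 3) z"
  by (simp add: z_def scl_distribs ac_simps)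

lemma tw_False_v [simp]: "tw False v = scl (R * t) v"
proof (rule ncser_eqI)
  fix a
  show "cf (tw False v) a = cf (scl (R * t) v) a"
    unfolding v_def tw_linear tw_mult tw_x tw_False_z ncs cf_simps using qt by algebra
qed

lemma tw_False_u [simp]: "tw False u = scl R u"
proof (rule ncser_eqI)
  fix a
  show "cf (tw False u) a = cf (scl R u) a"
    unfolding u_def tw_linear tw_mult tw_x tw_False_v ncs cf_simps using qt by algebra
qed

lemma tw_False_w [simp]: "tw False w = scl (R ^ 2 * t ^ 3) w"
proof (rule ncser_eqI)
  fix a
  show "cf (tw False w) a = cf (scl (R ^ 2 * t ^ 3) w) a"
    unfolding w_def tw_linear tw_mult tw_False_z tw_False_v ncs cf_simps by algebra
qed

lemma sd_False_z: "sd False z = scl cz x2"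
proof -
  have "cz = 1 - r * (t ^ 3 * R)"
    unfolding cz_def using rR by algebra
  then show ?thesis
    by (simp add: z_def sd_mult scl_diff_left)
qed

lemma sd_False_v: "sd False v = scl cv z"
proof (rule ncser_eqI)
  fix a
  show "cf (sd False v) a = cf (scl cv z) a"
    unfolding v_def sd_linear sd_mult sd_False_z sd_x tw_x tw_False_z
    unfolding z_def ncs cf_simps cz_def cv_def
    using qt rR by algebra
qed

lemma sd_False_u: "sd False u = scl cu v"
proof (rule ncser_eqI)
  fix a
  show "cf (sd False u) a = cf (scl cu v) a"
    unfolding u_def sd_linear sd_mult sd_False_v sd_x tw_x tw_False_v
    unfolding v_def ncs cf_simps cu_def cv_def
    using qt rR by algebra
qed

text \<open>Each of these elements lies in the ideal because its skew derivatives are combinations of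
  earlier ones.\<close>
definition "Rzx = z * x2 - scl (t ^ 3 * R) (x2 * z)"
definition "Rvx = v * x2 - scl (t ^ 3 * R ^ 2) (x2 * v) - scl (R * (t ^ 2 - 1)) (z * z)"
definition "Rwx = w * x2 - scl (t ^ 6 * R ^ 3) (x2 * w)
  - scl (R ^ 2 * (t ^ 2 - 1) * (t ^ 3 - t ^ 2)) (z * (z * z))"
definition "Rwz = w * z - scl (R * t ^ 3) (z * w)"
definition "Rvw = v * w - scl (R * t ^ 3) (w * v)"
text \<open>The value is forced: after rewriting \<open>z * z * x1\<close>, the terms
  \<open>v * z\<close> and \<open>z * v\<close> in \<open>sd False Rwx1\<close> cancel exactly when
  \<open>ck * cv = q ^ 2 * r * cw\<close>.\<close>

definition "ck = - cu / (1 + q)"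
definition "Rwx1 = w * x1 - scl (q ^ 3 * r ^ 2) (x1 * w) - scl ck (v * v)"
definition "Ruz = u * z - scl (R ^ 2 * t ^ 3) (z * u) - scl (ck * t * R) (v * v)"
definition "Ruv = u * v - scl (R * t ^ 3) (v * u)"
definition "Rux = u * x1 - scl (q ^ 3 * r) (x1 * u)"

lemma ck: "(1 + q) * ck = t - q ^ 2"
proof -
  have "1 + q \<noteq> 0"
    using q_ne(2) by (metis add.commute add_eq_0_iff2)
  then show ?thesis
    by (simp add: ck_def cu_def)
qed

lemma cf_Nil [simp]: "cf x1 [] = 0" "cf x2 [] = 0" "cf z [] = 0" "cf v [] = 0" "cf u [] = 0"
  "cf w [] = 0"
  by (simp_all add: z_def v_def u_def w_def x1_def x2_def cf_wd)

text \<open>The quantum Serre relation that is quadratic in \<open>x2\<close>.\<close>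

lemma Rzx: "Rzx \<in> nid"
proof (rule nidI)
  have "sd False Rzx = 0"
    by (simp add: Rzx_def sd_mult sd_False_z ac_simps)
  then show "sd False Rzx \<in> nid"
    by simp
  have "t ^ 3 * R * (r * q ^ 3) = 1"
    using qt rR by algebra
  then have "sd True Rzx = 0"
    by (simp add: Rzx_def sd_mult)
  then show "sd True Rzx \<in> nid"
    by simp
qed (simp add: Rzx_def)

text \<open>Skew commutation with \<open>x1\<close> turns \<open>z\<close> into \<open>v\<close>, so
  this relation is inherited from \<open>Rzx\<close> without differentiating.\<close>

lemma Rvx_eq: "Rvx = scl R (Rzx * x1) - scl (q * r) (x1 * Rzx)"
proof (rule ncser_eqI)
  fix a
  show "cf Rvx a = cf (scl R (Rzx * x1) - scl (q * r) (x1 * Rzx)) a"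
    unfolding Rvx_def Rzx_def v_def unfolding z_def ncs cf_simps
    using qt rR by algebra
qed

lemma Rvx: "Rvx \<in> nid"
  unfolding Rvx_eq by (intro nid_closed Rzx)

text \<open>\<open>x2\<close> is moved to the left through both products in the definition of
  \<open>w\<close>, using the relations for \<open>v\<close> and \<open>z\<close>.\<close>

lemma Rwx: "Rwx \<in> nid"
proof -
  have "Rwx = v * Rzx + scl (t ^ 3 * R) (Rvx * z) - scl (R * t ^ 2) (z * Rvx)
      - scl (R * t ^ 2 * (t ^ 3 * R ^ 2)) (Rzx * v)" (is "_ = ?e")
  proof (rule ncser_eqI)
    fix a
    show "cf Rwx a = cf ?e a"
      unfolding Rwx_def Rvx_def Rzx_def w_def ncs cf_simps
      by algebra
  qed
  then show ?thesis
    by (simp add: nid_closed Rzx Rvx)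
qed

text \<open>Differentiating leaves \<open>v * x2\<close> and \<open>x2 * v\<close>, which reduce to
  \<open>z * z\<close> only modulo the ideal; \<open>Rvx\<close> records the error exactly.\<close>

lemma sd_False_w: "sd False w = scl cw (z * z) + scl cz Rvx"
proof (rule ncser_eqI)
  fix a
  show "cf (sd False w) a = cf (scl cw (z * z) + scl cz Rvx) a"
    unfolding w_def sd_linear sd_mult sd_False_v sd_False_z sd_x tw_x tw_False_v tw_False_z
    unfolding Rvx_def ncs cf_simps cz_def cv_def cw_def
    by algebra
qed

lemma Rwz: "Rwz \<in> nid"
proof (rule nidI)
  have "sd False Rwz = scl cz Rwx + scl (cz * R * t ^ 2) (Rvx * z) - scl (R * t ^ 3 * cz) (z * Rvx)"
    (is "_ = ?e")
  proof (rule ncser_eqI)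
    fix a
    show "cf (sd False Rwz) a = cf ?e a"
      unfolding Rwz_def sd_linear sd_mult sd_False_w sd_False_z tw_False_w tw_False_z
      unfolding Rwx_def ncs cf_simps cz_def cv_def cw_def
      by algebra
  qed
  then show "sd False Rwz \<in> nid"
    by (simp add: nid_closed Rwx Rvx)
qed (simp_all add: Rwz_def sd_mult)

lemma Rvw: "Rvw \<in> nid"
proof (rule nidI)
  have "sd False Rvw = scl cz (v * Rvx) - scl (R ^ 2 * t ^ 4 * cz) (Rvx * v)
      + scl (cw - R * t ^ 3 * cv) Rwz" (is "_ = ?e")
  proof (rule ncser_eqI)
    fix a
    show "cf (sd False Rvw) a = cf ?e a"
      unfolding Rvw_def sd_linear sd_mult sd_False_w sd_False_v tw_False_w tw_False_v
      unfolding Rwz_def w_def ncs cf_simps cz_def cv_def cw_def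
      using qt rR by algebra
  qed
  then show "sd False Rvw \<in> nid"
    by (simp add: nid_closed Rwz Rvx)
qed (simp_all add: Rvw_def sd_mult)

lemma Rwx1: "Rwx1 \<in> nid"
proof (rule nidI)
  have "sd False Rwx1 = scl (q * cz) (Rvx * x1) - scl (q ^ 3 * r ^ 2 * cz) (x1 * Rvx)" (is "_ = ?e")
  proof (rule ncser_eqI)
    fix a
    show "cf (sd False Rwx1) a = cf ?e a"
      unfolding Rwx1_def sd_linear sd_mult sd_False_w sd_False_v tw_False_w tw_False_v sd_x tw_x
      unfolding w_def v_def ncs cf_simps cz_def cv_def cw_def
      using qt rR ck by algebra
  qed
  then show "sd False Rwx1 \<in> nid"
    by (simp add: nid_closed Rvx)
qed (simp_all add: Rwx1_def sd_mult)

text \<open>Pulling \<open>x1\<close> to the left through \<open>v\<close> and \<open>z\<close> in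
  \<open>w * x1\<close> gives x1 w with coefficient q^3 r^2 plus q r (u z - R^2 t^3 z u), with no
  relation used; so this is \<open>Rwx1\<close> up to a unit.\<close>

lemma Ruz: "Ruz \<in> nid"
proof -
  have "Ruz = scl (t * R) Rwx1"
  proof (rule ncser_eqI)
    fix a
    show "cf Ruz a = cf (scl (t * R) Rwx1) a"
      unfolding Ruz_def Rwx1_def u_def w_def v_def ncs cf_simps
      using qt rR by algebra
  qed
  then show ?thesis
    by (simp add: nid_closed Rwx1)
qed

lemma Ruv: "Ruv \<in> nid"
proof (rule nidI)
  have "sd False Ruv = scl cv Ruz"
  proof (rule ncser_eqI)
    fix a
    show "cf (sd False Ruv) a = cf (scl cv Ruz) a"
      unfolding Ruv_def sd_linear sd_mult sd_False_u sd_False_v tw_False_u tw_False_v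
      unfolding Ruz_def ncs cf_simps cv_def cu_def
      using qt rR ck by algebra
  qed
  then show "sd False Ruv \<in> nid"
    by (simp add: nid_closed Ruz)
qed (simp_all add: Ruv_def sd_mult)

text \<open>The other quantum Serre relation, of degree 4 in \<open>x1\<close>.\<close>

lemma Rux: "Rux \<in> nid"
proof (rule nidI)
  have "sd False Rux = 0"
  proof (rule ncser_eqI)
    fix a
    show "cf (sd False Rux) a = cf 0 a"
      unfolding Rux_def sd_linear sd_mult sd_False_u tw_False_u sd_x tw_x
      unfolding u_def ncs cf_simps cu_def
      using qt rR by algebra
  qed
  then show "sd False Rux \<in> nid"
    by simp
qed (simp_all add: Rux_def sd_mult)

end

section \<open>Vanishing powers of root vectors\<close>

context braiding
begin

text \<open>Moving \<open>g\<close> to the left past one \<open>y\<close> costs \<open>s\<close>,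
  twisting one \<open>y\<close> costs \<open>c\<close>. So \<open>a\<close> is the sum of all c^i
  s^(n-i), stated in division-free form.\<close>

lemma nid_power_lemma:
  assumes sd: "sd i y - g \<in> nid" and tw: "tw i y = scl c y" and comm: "y * g - scl s (g * y) \<in> nid"
  shows "\<exists>a. (c - s) * a = c ^ Suc n - s ^ Suc n \<and> sd i (y ^ Suc n) - scl a (g * y ^ n) \<in> nid"
proof (induction n)
  case 0
  show ?case
    using sd by (intro exI[of _ 1]) simp
next
  case (Suc n)
  then obtain a where a: "(c - s) * a = c ^ Suc n - s ^ Suc n"
    and ih: "sd i (y ^ Suc n) - scl a (g * y ^ n) \<in> nid"
    by blast
  have tw_pow: "tw i (y ^ m) = scl (c ^ m) (y ^ m)" for m
    by (induction m) (simp_all add: tw mult.commute)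
  let ?b = "s * a + c ^ Suc n"
  have "(c - s) * ?b = s * ((c - s) * a) + (c - s) * c ^ Suc n"
    by (simp add: algebra_simps)
  then have 1: "(c - s) * ?b = c ^ Suc (Suc n) - s ^ Suc (Suc n)"
    unfolding a by (simp add: algebra_simps)
  have 2: "sd i (y ^ Suc (Suc n)) - scl ?b (g * y ^ Suc n)
      = y * (sd i (y ^ Suc n) - scl a (g * y ^ n)) + scl a ((y * g - scl s (g * y)) * y ^ n)
        + scl (c ^ Suc n) ((sd i y - g) * y ^ Suc n)"
  proof -
    have "sd i (y ^ Suc (Suc n)) = y * sd i (y ^ Suc n) + scl (c ^ Suc n) (sd i y * y ^ Suc n)"
      by (subst power_Suc) (simp only: sd_mult tw_pow scl_mult_right)
    then show ?thesis
      by (simp add: ncs scl_add_left ac_simps)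
  qed
  have "sd i (y ^ Suc (Suc n)) - scl ?b (g * y ^ Suc n) \<in> nid"
    unfolding 2 by (intro nid_add nid_scl nid_mult_left[OF comm] nid_mult_right[OF ih] nid_mult_left[OF sd])
  with 1 show ?case
    by blast
qed

lemma sd_power_0: "sd i y = 0 \<Longrightarrow> sd i (y ^ n) = 0"
  by (induction n) (simp_all add: sd_mult)

lemma cf_power_Nil: "cf y [] = 0 \<Longrightarrow> 0 < n \<Longrightarrow> cf (y ^ n) [] = 0"
  by (cases n) simp_all

lemma nid_power:
  assumes "sd i y - g \<in> nid" "tw i y = scl c y" "y * g - scl s (g * y) \<in> nid"
    and "sd (\<not> i) y = 0" "cf y [] = 0" "0 < n" "c \<noteq> s" "c ^ n = s ^ n"
  shows "y ^ n \<in> nid"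
proof -
  obtain m where m: "n = Suc m"
    using assms(6) by (cases n) simp_all
  obtain a where "(c - s) * a = c ^ n - s ^ n" "sd i (y ^ n) - scl a (g * y ^ m) \<in> nid"
    using nid_power_lemma[OF assms(1-3), of m] unfolding m by blast
  then have "sd i (y ^ n) \<in> nid"
    using assms(7,8) by simp
  moreover have "sd (\<not> i) (y ^ n) \<in> nid"
    using assms(4) by (simp add: sd_power_0)
  ultimately have "sd j (y ^ n) \<in> nid" for j
    by (cases i; cases j) simp_all
  moreover have "cf (y ^ n) [] = 0"
    using assms(5,6) by (rule cf_power_Nil)
  ultimately show ?thesis
    using nid_iff by blast
qed

end

text \<open>Keeping the order \<open>M\<close> of \<open>q ^ 3\<close> as a separate parameter
  treats the cases \<open>3 dvd N\<close> and \<open>\<not> 3 dvd N\<close> at once.\<close>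

locale braiding_G2_order = braiding_G2 +
  fixes N M :: nat
  assumes N: "0 < N" "q ^ N = 1" "\<And>k. 0 < k \<Longrightarrow> k < N \<Longrightarrow> q ^ k \<noteq> 1"
    and M: "0 < M" "(q ^ 3) ^ M = 1" "\<And>k. 0 < k \<Longrightarrow> k < M \<Longrightarrow> (q ^ 3) ^ k \<noteq> 1"
begin

lemma nonzero: "q \<noteq> 0" "t \<noteq> 0" "r \<noteq> 0" "R \<noteq> 0"
  using qt rR by auto

lemma t_eq: "t = inverse q"
  using qt by (simp add: inverse_unique)

lemma t_N: "t ^ N = 1"
  by (simp add: t_eq N(2) power_inverse)

lemma t_M: "(t ^ 3) ^ M = 1"
  using M(2) by (simp add: t_eq power_inverse)

lemma t_ne: "t \<noteq> 1" "t \<noteq> -1" "t ^ 3 \<noteq> 1" "t ^ 2 \<noteq> 1"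
proof -
  show "t \<noteq> 1" "t ^ 3 \<noteq> 1"
    using q_ne by (simp_all add: t_eq power_inverse)
  show *: "t \<noteq> -1"
    using qt q_ne(2) by (metis minus_equation_iff mult_minus1_right)
  show "t ^ 2 \<noteq> 1"
    using * \<open>t \<noteq> 1\<close> by (simp add: power2_eq_1_iff)
qed

lemma x1_N: "x1 ^ N \<in> nid"
  by (rule nid_power[where i = False and g = 1 and c = q and s = 1])
    (use N(1,2) q_ne in simp_all)

lemma x2_M: "x2 ^ M \<in> nid"
  by (rule nid_power[where i = True and g = 1 and c = "q ^ 3" and s = 1]) (use M(1,2) q_ne in simp_all)

lemma z_N: "z ^ N \<in> nid"
proof (rule nid_power[where i = False and g = "scl cz x2" and c = "R * t ^ 2" and s = "t ^ 3 * R"])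
  have "z * scl cz x2 - scl (t ^ 3 * R) (scl cz x2 * z) = scl cz Rzx"
    by (simp add: Rzx_def ncs ac_simps)
  then show "z * scl cz x2 - scl (t ^ 3 * R) (scl cz x2 * z) \<in> nid"
    by (simp add: nid_closed Rzx)
  have "t ^ 3 * R = R * t ^ 2 * t"
    by algebra
  then show "R * t ^ 2 \<noteq> t ^ 3 * R"
    using nonzero t_ne by simp
  have "(t ^ k) ^ N = 1" for k
    using t_N by (metis power_commutes power_mult power_one mult.commute)
  then show "(R * t ^ 2) ^ N = (t ^ 3 * R) ^ N"
    by (simp add: power_mult_distrib)
qed (simp_all add: sd_False_z N(1))

lemma u_M: "u ^ M \<in> nid"
proof (rule nid_power[where i = False and g = "scl cu v" and c = R and s = "R * t ^ 3"])
  have "u * scl cu v - scl (R * t ^ 3) (scl cu v * u) = scl cu Ruv"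
    by (simp add: Ruv_def ncs ac_simps)
  then show "u * scl cu v - scl (R * t ^ 3) (scl cu v * u) \<in> nid"
    by (simp add: nid_closed Ruv)
  show "R \<noteq> R * t ^ 3"
    using nonzero t_ne by simp
  show "R ^ M = (R * t ^ 3) ^ M"
    by (simp add: power_mult_distrib t_M)
qed (simp_all add: sd_False_u M(1))

lemma w_M: "w ^ M \<in> nid"
proof (rule nid_power[where i = False and g = "scl cw (z * z)" and c = "R ^ 2 * t ^ 3"
      and s = "R ^ 2 * t ^ 3 * t ^ 3"])
  have "w * scl cw (z * z) - scl (R ^ 2 * t ^ 3 * t ^ 3) (scl cw (z * z) * w)
      = scl cw (Rwz * z) + scl (cw * (R * t ^ 3)) (z * Rwz)"
    by (simp add: Rwz_def ncs ac_simps power2_eq_square)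
  then show "w * scl cw (z * z) - scl (R ^ 2 * t ^ 3 * t ^ 3) (scl cw (z * z) * w) \<in> nid"
    by (simp add: nid_closed Rwz)
  show "R ^ 2 * t ^ 3 \<noteq> R ^ 2 * t ^ 3 * t ^ 3"
    using nonzero t_ne by simp
  show "(R ^ 2 * t ^ 3) ^ M = (R ^ 2 * t ^ 3 * t ^ 3) ^ M"
    by (simp add: power_mult_distrib[of _ "t ^ 3"] t_M)
qed (simp_all add: sd_False_w M(1) nid_closed Rvx)

text \<open>\<open>nid_power\<close> does not apply to \<open>v\<close>: its derivative is a
  multiple of \<open>z\<close>, and \<open>v * z\<close> equals \<open>b\<close> times
  \<open>z * v\<close> plus \<open>w\<close>, so a second term with \<open>w\<close> appears. Up to
  \<open>cv\<close>, the coefficients \<open>a\<close> and \<open>e\<close> are the complete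
  homogeneous polynomials of degree n+1 in b, c and of degree n in b, c, s.\<close>

lemma sd_False_v_power:
  fixes n
  assumes c_def: "c = R * t" and b_def: "b = R * t ^ 2" and s_def: "s = R * t ^ 3"
  shows "\<exists>a e. (c - b) * a = cv * (c ^ (n + 2) - b ^ (n + 2))
    \<and> (c - b) * (c - s) * (b - s) * e
        = cv * ((b - s) * (c ^ (n + 2) - s ^ (n + 2)) - (c - s) * (b ^ (n + 2) - s ^ (n + 2)))
    \<and> sd False (v ^ (n + 2)) - scl a (z * v ^ (n + 1)) - scl e (w * v ^ n) \<in> nid"
proof (induction n)
  case 0
  have "sd False (v ^ 2) = scl (cv * (b + c)) (z * v) + scl cv w"
    by (simp add: power2_eq_square sd_mult sd_False_v w_def b_def c_def ncs scl_add_left ac_simps)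
  moreover have "(c - b) * (cv * (b + c)) = cv * (c ^ 2 - b ^ 2)"
    "(c - b) * (c - s) * (b - s) * cv = cv * ((b - s) * (c ^ 2 - s ^ 2) - (c - s) * (b ^ 2 - s ^ 2))"
    by algebra+
  ultimately show ?case
    by (intro exI[of _ "cv * (b + c)"] exI[of _ cv] conjI)
      (simp_all only: add_0 power_0 mult_1_right power_one_right, simp_all)
next
  case (Suc n)
  then obtain a e where a: "(c - b) * a = cv * (c ^ (n + 2) - b ^ (n + 2))"
    and e: "(c - b) * (c - s) * (b - s) * e
      = cv * ((b - s) * (c ^ (n + 2) - s ^ (n + 2)) - (c - s) * (b ^ (n + 2) - s ^ (n + 2)))"
    and ih: "sd False (v ^ (n + 2)) - scl a (z * v ^ (n + 1)) - scl e (w * v ^ n) \<in> nid"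
    by blast
  have tw_pow: "tw False (v ^ m) = scl (c ^ m) (v ^ m)" for m
    by (induction m) (simp_all add: c_def mult.commute)
  let ?a = "b * a + cv * c ^ (n + 2)" and ?e = "a + s * e"
  let ?P = "sd False (v ^ (n + 2))" and ?Z1 = "z * v ^ (n + 1)" and ?Z2 = "z * v ^ (n + 2)"
    and ?W0 = "w * v ^ n" and ?W1 = "w * v ^ (n + 1)"
  have f1: "sd False (v ^ (Suc n + 2)) = v * ?P + scl (cv * c ^ (n + 2)) ?Z2"
    using sd_mult[of False v "v ^ (n + 2)"] by (simp only: tw_pow sd_False_v) (simp add: mult.commute[of _ cv])
  have f2: "v * ?Z1 = ?W1 + scl b ?Z2"
    by (simp add: w_def b_def left_diff_distrib mult.assoc)
  have f3: "v * ?W0 = Rvw * v ^ n + scl s ?W1"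
    by (simp add: Rvw_def s_def left_diff_distrib mult.assoc)
  have "sd False (v ^ (Suc n + 2)) - scl ?a ?Z2 - scl ?e ?W1
     = v * (?P - scl a ?Z1 - scl e ?W0) + scl e (Rvw * v ^ n)"
    unfolding f1 right_diff_distrib scl_mult_right f2 f3
    by (rule ncser_eqI)
      (simp only: cf_simps distrib_left distrib_right add_diff_eq diff_diff_eq mult.assoc, simp add: ac_simps)
  also have "\<dots> \<in> nid"
    by (intro nid_add nid_scl nid_mult_left[OF Rvw] nid_mult_right[OF ih])
  finally have 1: "sd False (v ^ (Suc n + 2)) - scl ?a (z * v ^ (Suc n + 1))
      - scl ?e (w * v ^ Suc n) \<in> nid"
    by simp
  have 2: "(c - b) * ?a = cv * (c ^ (Suc n + 2) - b ^ (Suc n + 2))"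
  proof -
    have "(c - b) * ?a = b * ((c - b) * a) + (c - b) * (cv * c ^ (n + 2))"
      by (simp add: algebra_simps)
    then show ?thesis
      unfolding a by (simp add: algebra_simps)
  qed
  have 3: "(c - b) * (c - s) * (b - s) * ?e
      = cv * ((b - s) * (c ^ (Suc n + 2) - s ^ (Suc n + 2)) - (c - s) * (b ^ (Suc n + 2) - s ^ (Suc n + 2)))"
  proof -
    have "(c - b) * (c - s) * (b - s) * ?e
        = (c - s) * (b - s) * ((c - b) * a) + s * ((c - b) * (c - s) * (b - s) * e)"
      by (simp only: distrib_left mult.assoc mult.left_commute)
    then show ?thesis
      unfolding a e by (simp add: algebra_simps)
  qed
  show ?case
    using 1 2 3 by blast
qed

lemma v_N: "v ^ N \<in> nid"
proof (rule nidI)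
  \<comment> \<open>The two-term formula starts at the square of \<open>v\<close>, so
    \<open>N\<close> must be at least 2.\<close>
  have "N \<noteq> 1"
    using N(2) q_ne(1) by auto
  with N(1) obtain n where n: "N = n + 2"
    by (metis One_nat_def add_2_eq_Suc' gr0_conv_Suc not0_implies_Suc)
  obtain a e where ae: "(R * t - R * t ^ 2) * a = cv * ((R * t) ^ N - (R * t ^ 2) ^ N)"
     "(R * t - R * t ^ 2) * (R * t - R * t ^ 3) * (R * t ^ 2 - R * t ^ 3) * e
        = cv * ((R * t ^ 2 - R * t ^ 3) * ((R * t) ^ N - (R * t ^ 3) ^ N)
                - (R * t - R * t ^ 3) * ((R * t ^ 2) ^ N - (R * t ^ 3) ^ N))"
     "sd False (v ^ N) - scl a (z * v ^ (n + 1)) - scl e (w * v ^ n) \<in> nid"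
    using sd_False_v_power[OF refl refl refl, of n] unfolding n by blast
  \<comment> \<open>The three scalars differ by powers of \<open>t\<close>, so their
    \<open>N\<close>-th powers agree and both coefficients vanish.\<close>
  have "(t ^ k) ^ N = 1" for k
    using t_N by (metis power_commutes power_mult power_one mult.commute)
  then have pw: "(R * t) ^ N = R ^ N" "(R * t ^ 2) ^ N = R ^ N" "(R * t ^ 3) ^ N = R ^ N"
    using t_N by (simp_all add: power_mult_distrib)
  have "R * t - R * t ^ 2 = R * t * (1 - t)" "R * t - R * t ^ 3 = R * t * (1 - t ^ 2)"
    "R * t ^ 2 - R * t ^ 3 = R * t ^ 2 * (1 - t)"
    by algebra+
  then have "R * t - R * t ^ 2 \<noteq> 0" "R * t - R * t ^ 3 \<noteq> 0" "R * t ^ 2 - R * t ^ 3 \<noteq> 0"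
    using nonzero t_ne by auto
  then have "a = 0" "e = 0"
    using ae(1,2) unfolding pw by simp_all
  then show "sd False (v ^ N) \<in> nid"
    using ae(3) by simp
qed (simp_all add: cf_power_Nil N(1) sd_power_0)

end

section \<open>Leading words and the upper bound\<close>

text \<open>Binary value: on words of equal length this is the lexicographic order with
  \<open>x1\<close> below \<open>x2\<close>, in arithmetic form.\<close>

fun bval :: "bool list \<Rightarrow> nat" where
  "bval [] = 0"
| "bval (b # w) = (if b then 2 ^ length w else 0) + bval w"

lemma bval_less: "bval w < 2 ^ length w"
  by (induction w) auto

lemma bval_append: "bval (u @ v) = bval u * 2 ^ length v + bval v"
  by (induction u) (auto simp: power_add algebra_simps)

lemma bval_inj: "length u = length v \<Longrightarrow> bval u = bval v \<Longrightarrow> u = v"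
proof (induction u v rule: list_induct2)
  case (Cons a u b v)
  then show ?case
    using bval_less[of u] bval_less[of v] by (auto split: if_splits)
qed simp

lemma bval_append_mono:
  assumes "length u' = length u" "length v' = length v" "bval u \<le> bval u'" "bval v \<le> bval v'"
  shows "bval (u @ v) \<le> bval (u' @ v')"
  using assms by (simp add: bval_append add_mono)

definition lead :: "'a::field ncser \<Rightarrow> bool list \<Rightarrow> bool" where
  "lead f l \<longleftrightarrow> cf f l \<noteq> 0 \<and> (\<forall>w. cf f w \<noteq> 0 \<longrightarrow> length w = length l \<and> bval l \<le> bval w)"

lemma lead_nz: "lead f l \<Longrightarrow> cf f l \<noteq> 0"
  and lead_min: "lead f l \<Longrightarrow> cf f w \<noteq> 0 \<Longrightarrow> length w = length l \<and> bval l \<le> bval w"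
  unfolding lead_def by blast+

lemma lead_wd: "lead (wd u) u"
  by (simp add: lead_def cf_wd)

lemma lead_1: "lead 1 []"
  by (simp add: lead_def)

text \<open>All words in the support of \<open>f\<close> have one length, so only the cut after
  \<open>length l\<close> letters contributes, and the coefficient at \<open>l @ m\<close> is a
  single nonzero product.\<close>

lemma lead_mult:
  assumes "lead f l" "lead g m"
  shows "lead (f * g) (l @ m)"
proof -
  have z: "cf f (take k w) * cf g (drop k w) = 0 \<or>
      k = length l \<and> length w = length (l @ m) \<and> bval (l @ m) \<le> bval w" if "k \<le> length w" for k w
  proof (cases "cf f (take k w) = 0 \<or> cf g (drop k w) = 0")
    case False
    then have len: "length (take k w) = length l" "length (drop k w) = length m"
      and le: "bval l \<le> bval (take k w)" "bval m \<le> bval (drop k w)"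
      using lead_min[OF assms(1), of "take k w"] lead_min[OF assms(2), of "drop k w"] by blast+
    have "bval (l @ m) \<le> bval (take k w @ drop k w)"
      by (rule bval_append_mono[OF len le])
    moreover have "k = length l"
      using len(1) that by simp
    moreover have "length w = length (l @ m)"
      using len that by simp
    ultimately show ?thesis
      by simp
  qed (elim disjE; simp)
  have eq: "cf (f * g) (l @ m) = (\<Sum>k\<le>length (l @ m). if k = length l then cf f l * cf g m else 0)"
    unfolding cf_mult tmult_def
  proof (rule sum.cong)
    fix k assume "k \<in> {..length (l @ m)}"
    then show "cf f (take k (l @ m)) * cf g (drop k (l @ m)) = (if k = length l then cf f l * cf g m else 0)"
      using z[of k "l @ m"] by (cases "k = length l") simp_all
  qed simp
  have "cf (f * g) (l @ m) \<noteq> 0"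
    unfolding eq using assms[THEN lead_nz] by simp
  moreover have "length w = length (l @ m) \<and> bval (l @ m) \<le> bval w" if "cf (f * g) w \<noteq> 0" for w
  proof -
    have "\<exists>k\<in>{..length w}. cf f (take k w) * cf g (drop k w) \<noteq> 0"
      using that unfolding cf_mult tmult_def by (meson sum.neutral)
    then show ?thesis
      using z by (meson atMost_iff)
  qed
  ultimately show ?thesis
    unfolding lead_def by blast
qed

lemma lead_power: "lead f l \<Longrightarrow> lead (f ^ n) (concat (replicate n l))"
  by (induction n) (simp_all add: lead_1 lead_mult)

lemma lead_diffI:
  assumes "cf (f - scl c g) l \<noteq> 0" "length w' = length l" "length w'' = length l"
    and "bval l \<le> bval w'" "bval l \<le> bval w''"
    and f: "\<And>w. cf f w \<noteq> 0 \<Longrightarrow> length w = length w' \<and> bval w' \<le> bval w"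
    and g: "\<And>w. cf g w \<noteq> 0 \<Longrightarrow> length w = length w'' \<and> bval w'' \<le> bval w"
  shows "lead (f - scl c g) l"
  unfolding lead_def
proof (intro conjI allI impI)
  fix w
  assume "cf (f - scl c g) w \<noteq> 0"
  then have "cf f w \<noteq> 0 \<or> cf g w \<noteq> 0"
    by auto
  then have "length w = length w' \<and> bval w' \<le> bval w \<or> length w = length w'' \<and> bval w'' \<le> bval w"
    using f g by blast
  then show "length w = length l" "bval l \<le> bval w"
    using assms(2-5) by linarith+
qed (fact assms(1))

lemma lead_diff_left:
  assumes f: "lead f l" and g: "lead g m" and "length m = length l" "bval l < bval m"
  shows "lead (f - scl c g) l"
proof (rule lead_diffI[where w' = l and w'' = m])
  have "cf g l = 0"
    using lead_min[OF g] assms(4) by (meson not_le)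
  then show "cf (f - scl c g) l \<noteq> 0"
    using lead_nz[OF f] by simp
qed (use assms(3,4) lead_min[OF f] lead_min[OF g] in auto)

lemma lead_diff_right:
  assumes f: "lead f l" and g: "lead g m" and "length l = length m" "bval m < bval l" "c \<noteq> 0"
  shows "lead (f - scl c g) m"
proof (rule lead_diffI[where w' = l and w'' = m])
  have "cf f m = 0"
    using lead_min[OF f] assms(4) by (meson not_le)
  then show "cf (f - scl c g) m \<noteq> 0"
    using lead_nz[OF g] assms(5) by simp
qed (use assms(3,4) lead_min[OF f] lead_min[OF g] in auto)

interpretation ncv: vector_space scl
  by unfold_locales (auto simp: scl_add scl_add_left)

section \<open>The quotient and reduction to normal words\<close>

context braiding
begin

text \<open>The quotient by the ideal is realised as the range of this map.\<close>
definition Phi :: "'a ncser \<Rightarrow> 'a ncser" where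
  "Phi f = NC (\<lambda>js. cf (sds js f) [])"

lemma Phi_linear: "Phi (f + g) = Phi f + Phi g" "Phi (f - g) = Phi f - Phi g"
    "Phi (scl c f) = scl c (Phi f)" "Phi 0 = 0"
  by (auto intro!: ncser_eqI simp: Phi_def sds_linear)

lemma Phi_sum: "Phi (sum f A) = (\<Sum>x\<in>A. Phi (f x))"
  by (induction A rule: infinite_finite_induct) (auto simp: Phi_linear)

lemma Phi_0_iff: "Phi f = 0 \<longleftrightarrow> f \<in> nid"
proof -
  have "Phi f = 0 \<longleftrightarrow> (\<forall>js. cf (Phi f) js = 0)"
    by (metis cf_simps(1) ncser_eqI)
  then show ?thesis
    by (simp add: Phi_def nid_iff_sds)
qed

lemma Phi_eq_iff: "Phi f = Phi g \<longleftrightarrow> f - g \<in> nid"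
  by (metis Phi_0_iff Phi_linear(2) eq_iff_diff_eq_0)

lemma ncser_homogeneous_expand:
  assumes "\<And>w. cf f w \<noteq> 0 \<Longrightarrow> length w = n"
  shows "f = (\<Sum>w | length w = n. scl (cf f w) (wd w))"
proof (rule ncser_eqI)
  fix w
  have fin: "finite {w :: bool list. length w = n}"
    using finite_lists_length_eq[of "UNIV :: bool set" n] by simp
  have "cf (\<Sum>u | length u = n. scl (cf f u) (wd u)) w = (\<Sum>u | length u = n. if w = u then cf f w else 0)"
    by (simp add: cf_wd) (rule sum.cong, auto)
  also have "\<dots> = cf f w"
    using fin assms[of w] by auto
  finally show "cf f w = cf (\<Sum>u | length u = n. scl (cf f u) (wd u)) w"
    by simp
qed

text \<open>Rewriting with leading words terminates because a word is replaced by lexicographically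
  larger words of the same length.\<close>
lemma Phi_wd_in_span_normal:
  assumes red: "\<And>w. \<not> nrm w \<Longrightarrow> \<exists>a l b f. w = a @ l @ b \<and> f \<in> nid \<and> lead f l"
  shows "Phi (wd w) \<in> ncv.span ((\<lambda>w. Phi (wd w)) ` {u. nrm u \<and> length u = length w})"
proof (induction "2 ^ length w - bval w" arbitrary: w rule: less_induct)
  case less
  show ?case
  proof (cases "nrm w")
    case True
    then show ?thesis
      by (intro ncv.span_base) auto
  next
    case False
    then obtain a l b f where w: "w = a @ l @ b" and f: "f \<in> nid" "lead f l"
      using red by blast
    define h where "h = wd a * (f * wd b)"
    have lh: "lead h w"
      unfolding h_def w by (intro lead_mult lead_wd f)
    have "h \<in> nid"
      unfolding h_def by (intro nid_mult_right nid_mult_left f)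
    have h: "h = (\<Sum>u | length u = length w. scl (cf h u) (wd u))"
      using lead_min[OF lh] by (intro ncser_homogeneous_expand) blast
    have fin: "finite {u :: bool list. length u = length w}"
      using finite_lists_length_eq[of "UNIV :: bool set" "length w"] by simp
    have "0 = Phi h"
      using \<open>h \<in> nid\<close> by (simp add: Phi_0_iff)
    also have "\<dots> = (\<Sum>u | length u = length w. scl (cf h u) (Phi (wd u)))"
      by (subst h) (simp add: Phi_sum Phi_linear)
    also have "\<dots> = scl (cf h w) (Phi (wd w))
        + (\<Sum>u\<in>{u. length u = length w} - {w}. scl (cf h u) (Phi (wd u)))"
      by (intro sum.remove fin) simp
    finally have "scl (cf h w) (Phi (wd w))
        = - (\<Sum>u\<in>{u. length u = length w} - {w}. scl (cf h u) (Phi (wd u)))"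
      by (simp add: eq_neg_iff_add_eq_0)
    also have "\<dots> \<in> ncv.span ((\<lambda>w. Phi (wd w)) ` {u. nrm u \<and> length u = length w})"
    proof (intro ncv.span_neg ncv.span_sum)
      fix u
      assume u: "u \<in> {u. length u = length w} - {w}"
      show "scl (cf h u) (Phi (wd u)) \<in> ncv.span ((\<lambda>w. Phi (wd w)) ` {u. nrm u \<and> length u = length w})"
      proof (cases "cf h u = 0")
        case False
        then have "bval w \<le> bval u"
          using lead_min[OF lh] by blast
        moreover have "bval w \<noteq> bval u"
          using u bval_inj by auto
        ultimately have "2 ^ length u - bval u < 2 ^ length w - bval w"
          using u bval_less[of u] by simp
        then show ?thesis
          using less[of u] u by (intro ncv.span_scale) simp
      qed (simp add: ncv.span_zero)
    qed
    finally have "scl (inverse (cf h w)) (scl (cf h w) (Phi (wd w)))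
        \<in> ncv.span ((\<lambda>w. Phi (wd w)) ` {u. nrm u \<and> length u = length w})"
      by (rule ncv.span_scale)
    moreover have "cf h w \<noteq> 0"
      using lh by (rule lead_nz)
    ultimately show ?thesis
      by simp
  qed
qed

end

section \<open>Words avoiding the obstructions\<close>

definition rep :: "nat \<Rightarrow> bool list \<Rightarrow> bool list" where
  "rep n w = concat (replicate n w)"

lemma rep_simps [simp]: "rep 0 w = []" "rep (Suc n) w = w @ rep n w"
  by (simp_all add: rep_def)

lemma rep_Suc_right: "rep (Suc n) w = rep n w @ w"
  by (induction n) simp_all

definition factor :: "'a list \<Rightarrow> 'a list \<Rightarrow> bool" where
  "factor l w \<longleftrightarrow> (\<exists>a b. w = a @ l @ b)"

lemma factor_append: "factor l u \<Longrightarrow> factor l (u @ v)" "factor l v \<Longrightarrow> factor l (u @ v)"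
  unfolding factor_def by (metis append.assoc)+

lemma factor_refl: "factor l l" "factor l (a @ l @ b)"
  unfolding factor_def by (metis append_Nil append_Nil2, metis)

abbreviation "lz \<equiv> [False, True]"
abbreviation "lv \<equiv> [False, False, True]"
abbreviation "lu \<equiv> [False, False, False, True]"
abbreviation "lw \<equiv> [False, False, True, False, True]"

text \<open>The good Lyndon words of type \<open>G\<^sub>2\<close> are 1, 1112, 112, 11212, 12, 2 with False as 1; an
  obstruction is the leading word of one of the q-commutation relations.\<close>
definition obstructions :: "bool list set" where
  "obstructions = {lz @ [True], lu @ lz, [False] @ lu, lu @ lv, lv @ lw, lw @ lz}"

text \<open>The blocks decrease in lexicographic order, so this is the Lyndon factorization of the
  word.\<close>

definition npw :: "nat \<Rightarrow> nat \<Rightarrow> nat \<Rightarrow> nat \<Rightarrow> nat \<Rightarrow> nat \<Rightarrow> bool list" where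
  "npw a b c d e f = rep a [True] @ rep b lz @ rep c lw @ rep d lv @ rep e lu @ rep f [False]"

lemma npw_snoc_False: "npw a b c d e f @ [False] = npw a b c d e (Suc f)"
  by (simp add: npw_def rep_Suc_right del: rep_simps(2))

definition ofree :: "bool list \<Rightarrow> bool" where
  "ofree w \<longleftrightarrow> (\<forall>l\<in>obstructions. \<not> factor l w)"

lemma not_ofree: "l \<in> obstructions \<Longrightarrow> \<not> ofree (a @ l @ b)"
  unfolding ofree_def using factor_refl(2) by blast

text \<open>The obstructions in the shape in which they arise at the right end of a word. The first
  four are all \<open>lz @ [True]\<close>, since every longer block ends in \<open>lz\<close>; the
  seventh is \<open>lv @ lw\<close>.\<close>

lemma not_ofree_instances:
  "\<not> ofree (a @ lz @ [True])" "\<not> ofree (a @ lv @ [True])" "\<not> ofree (a @ lu @ [True])"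
  "\<not> ofree (a @ lw @ [True])" "\<not> ofree (a @ lu @ lz)" "\<not> ofree (a @ lu @ lv)"
  "\<not> ofree (a @ lv @ lv @ lz)" "\<not> ofree (a @ lw @ lz)" "\<not> ofree (a @ [False] @ lu)"
  using not_ofree[of "lz @ [True]" a "[]"] not_ofree[of "lz @ [True]" "a @ [False]" "[]"]
    not_ofree[of "lz @ [True]" "a @ [False, False]" "[]"]
    not_ofree[of "lz @ [True]" "a @ [False, False, True]" "[]"]
    not_ofree[of "lu @ lz" a "[]"] not_ofree[of "lu @ lv" a "[]"] not_ofree[of "lv @ lw" a "[]"]
    not_ofree[of "lw @ lz" a "[]"] not_ofree[of "[False] @ lu" a "[]"]
  by (simp_all add: obstructions_def)

text \<open>The final run of \<open>f\<close> letters \<open>False\<close> and the new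
  \<open>True\<close> form a new Lyndon factor determined by \<open>f\<close>. The obstructions rule
  out smaller factors before it, except that a single \<open>lv\<close> followed by
  \<open>lz\<close> merges into \<open>lw\<close>.\<close>

lemma npw_snoc_True:
  assumes "ofree (npw a b c d e f @ [True])"
  shows "\<exists>a' b' c' d' e'. npw a b c d e f @ [True] = npw a' b' c' d' e' 0"
proof -
  let ?p = "rep a [True] @ rep b lz @ rep c lw @ rep d lv @ rep e lu"
  note snoc = rep_Suc_right and expand = rep_simps(2)
  consider "f = 0" | "f = 1" | "f = 2" | "f = 3" | "4 \<le> f"
    by linarith
  then show ?thesis
  proof cases
    case 1
    have "e = 0"
      using assms not_ofree_instances(3)[of "rep a [True] @ rep b lz @ rep c lw @ rep d lv @ rep (e - 1) lu"] 1
      by (cases e) (simp_all add: npw_def snoc del: expand)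
    moreover have "d = 0"
      using assms not_ofree_instances(2)[of "rep a [True] @ rep b lz @ rep c lw @ rep (d - 1) lv"] 1 calculation
      by (cases d) (simp_all add: npw_def snoc del: expand)
    moreover have "c = 0"
      using assms not_ofree_instances(4)[of "rep a [True] @ rep b lz @ rep (c - 1) lw"] 1 calculation
      by (cases c) (simp_all add: npw_def snoc del: expand)
    moreover have "b = 0"
      using assms not_ofree_instances(1)[of "rep a [True] @ rep (b - 1) lz"] 1 calculation
      by (cases b) (simp_all add: npw_def snoc del: expand)
    ultimately have "npw a b c d e f @ [True] = npw (Suc a) 0 0 0 0 0"
      using 1 by (simp add: npw_def snoc del: expand)
    then show ?thesis
      by blast
  next
    case 2
    have e: "e = 0"
      using assms not_ofree_instances(5)[of "rep a [True] @ rep b lz @ rep c lw @ rep d lv @ rep (e - 1) lu"] 2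
      by (cases e) (simp_all add: npw_def snoc del: expand)
    consider "d = 0" | "d = 1" | d' where "d = Suc (Suc d')"
      by (cases d rule: nat.exhaust) (auto, metis not0_implies_Suc)
    then show ?thesis
    proof cases
      case 1
      have "c = 0"
        using assms not_ofree_instances(8)[of "rep a [True] @ rep b lz @ rep (c - 1) lw"] e 1 2
        by (cases c) (simp_all add: npw_def snoc del: expand)
      then have "npw a b c d e f @ [True] = npw a (Suc b) 0 0 0 0"
        using 1 2 e by (simp add: npw_def snoc del: expand)
      then show ?thesis
        by blast
    next
      case 2
      \<comment> \<open>Here \<open>lv @ lz\<close> is literally \<open>lw\<close>.\<close>
      then have "npw a b c d e f @ [True] = npw a b (Suc c) 0 0 0"
        using \<open>f = 1\<close> e by (simp add: npw_def snoc del: expand)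
      then show ?thesis
        by blast
    next
      case 3
      then show ?thesis
        using assms not_ofree_instances(7)[of "rep a [True] @ rep b lz @ rep c lw @ rep d' lv"] e 2
        by (simp add: npw_def snoc del: expand)
    qed
  next
    case 3
    have e: "e = 0"
      using assms not_ofree_instances(6)[of "rep a [True] @ rep b lz @ rep c lw @ rep d lv @ rep (e - 1) lu"] 3
      by (cases e) (simp_all add: npw_def snoc del: expand add: numeral_2_eq_2)
    then have "npw a b c d e f @ [True] = npw a b c (Suc d) 0 0"
      using 3 by (simp add: npw_def snoc numeral_2_eq_2 del: expand)
    then show ?thesis
      by blast
  next
    case 4
    then have "npw a b c d e f @ [True] = npw a b c d (Suc e) 0"
      by (simp add: npw_def snoc numeral_3_eq_3 del: expand)
    then show ?thesis
      by blast
  next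
    case 5
    then obtain k where "f = 4 + k"
      using le_Suc_ex by blast
    then have f: "f = Suc (Suc (Suc (Suc k)))"
      by simp
    show ?thesis
      using assms not_ofree_instances(9)[of "?p @ rep k [False]"]
      by (simp add: f npw_def snoc del: expand)
  qed
qed

lemma ofree_appendD: "ofree (u @ v) \<Longrightarrow> ofree u"
  by (auto simp: ofree_def factor_append)

lemma ofree_npw: "ofree w \<Longrightarrow> \<exists>a b c d e f. w = npw a b c d e f"
proof (induction w rule: rev_induct)
  case Nil
  have "[] = npw 0 0 0 0 0 0"
    by (simp add: npw_def)
  then show ?case
    by blast
next
  case (snoc x w)
  then obtain a b c d e f where w: "w = npw a b c d e f"
    using ofree_appendD by blast
  show ?case
  proof (cases x)
    case True
    then show ?thesis
      using snoc.prems npw_snoc_True[of a b c d e f] unfolding w by simp blast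
  next
    case False
    then show ?thesis
      unfolding w using npw_snoc_False[of a b c d e f] by simp blast
  qed
qed

lemma factor_rep: "n \<le> m \<Longrightarrow> factor (rep n l) (u @ rep m l @ v)"
proof -
  assume "n \<le> m"
  then have "rep m l = rep n l @ rep (m - n) l"
    unfolding rep_def by (metis concat_append le_add_diff_inverse replicate_add)
  then show ?thesis
    by (metis append.assoc factor_refl(2))
qed

lemma factor_npw:
  "n \<le> a \<Longrightarrow> factor (rep n [True]) (npw a b c d e f)"
  "n \<le> b \<Longrightarrow> factor (rep n lz) (npw a b c d e f)"
  "n \<le> c \<Longrightarrow> factor (rep n lw) (npw a b c d e f)"
  "n \<le> d \<Longrightarrow> factor (rep n lv) (npw a b c d e f)"
  "n \<le> e \<Longrightarrow> factor (rep n lu) (npw a b c d e f)"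
  "n \<le> f \<Longrightarrow> factor (rep n [False]) (npw a b c d e f)"
  using factor_rep[of n a "[True]" "[]"] factor_rep[of n b lz "rep a [True]"]
    factor_rep[of n c lw "rep a [True] @ rep b lz"]
    factor_rep[of n d lv "rep a [True] @ rep b lz @ rep c lw"]
    factor_rep[of n e lu "rep a [True] @ rep b lz @ rep c lw @ rep d lv"]
    factor_rep[of n f "[False]" "rep a [True] @ rep b lz @ rep c lw @ rep d lv @ rep e lu" "[]"]
  by (simp_all add: npw_def)

section \<open>Leading words of the root vectors and relations\<close>

context braiding_G2_order
begin

lemma lead_x: "lead x1 [False]" "lead x2 [True]"
  by (simp_all add: x1_def x2_def lead_wd)

lemma lead_z: "lead z lz"
  unfolding z_def
  using lead_diff_right[OF lead_mult[OF lead_x(2,1)] lead_mult[OF lead_x(1,2)], of r] nonzero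
  by simp

lemma lead_v: "lead v lv"
  unfolding v_def
  using lead_diff_right[OF lead_mult[OF lead_z lead_x(1)] lead_mult[OF lead_x(1) lead_z], of "q * r"] nonzero
  by simp

lemma lead_u: "lead u lu"
  unfolding u_def
  using lead_diff_right[OF lead_mult[OF lead_v lead_x(1)] lead_mult[OF lead_x(1) lead_v], of "q ^ 2 * r"] nonzero
  by simp

lemma lead_w: "lead w lw"
  unfolding w_def
  using lead_diff_left[OF lead_mult[OF lead_v lead_z] lead_mult[OF lead_z lead_v]]
  by simp

lemma lead_obstructions:
  assumes "l \<in> obstructions"
  shows "\<exists>f\<in>nid. lead f l"
proof -
  have "lead Rzx (lz @ [True])"
    unfolding Rzx_def
    using lead_diff_left[OF lead_mult[OF lead_z lead_x(2)] lead_mult[OF lead_x(2) lead_z]] by simp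
  then have "\<exists>f\<in>nid. lead f (lz @ [True])"
    using Rzx by (rule bexI)
  moreover have "lead Rux ([False] @ lu)"
    unfolding Rux_def using nonzero
      lead_diff_right[OF lead_mult[OF lead_u lead_x(1)] lead_mult[OF lead_x(1) lead_u], of "q ^ 3 * r"]
    by simp
  then have "\<exists>f\<in>nid. lead f ([False] @ lu)"
    using Rux by (rule bexI)
  moreover have "lead Ruv (lu @ lv)"
    unfolding Ruv_def
    using lead_diff_left[OF lead_mult[OF lead_u lead_v] lead_mult[OF lead_v lead_u]] by simp
  then have "\<exists>f\<in>nid. lead f (lu @ lv)"
    using Ruv by (rule bexI)
  moreover have "lead Rvw (lv @ lw)"
    unfolding Rvw_def
    using lead_diff_left[OF lead_mult[OF lead_v lead_w] lead_mult[OF lead_w lead_v]] by simp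
  then have "\<exists>f\<in>nid. lead f (lv @ lw)"
    using Rvw by (rule bexI)
  moreover have "lead Rwz (lw @ lz)"
    unfolding Rwz_def
    using lead_diff_left[OF lead_mult[OF lead_w lead_z] lead_mult[OF lead_z lead_w]] by simp
  then have "\<exists>f\<in>nid. lead f (lw @ lz)"
    using Rwz by (rule bexI)
  \<comment> \<open>\<open>[False] @ lw\<close> and \<open>lu @ lz\<close> are the same word; this
    is why one obstruction serves both pairs.\<close>
  moreover have "lead (w * x1 - scl (q ^ 3 * r ^ 2) (x1 * w)) (lu @ lz)"
    using nonzero
      lead_diff_right[OF lead_mult[OF lead_w lead_x(1)] lead_mult[OF lead_x(1) lead_w], of "q ^ 3 * r ^ 2"]
    by simp
  then have "lead Rwx1 (lu @ lz)"
    unfolding Rwx1_def using lead_diff_left[OF _ lead_mult[OF lead_v lead_v]] by simp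
  then have "\<exists>f\<in>nid. lead f (lu @ lz)"
    using Rwx1 by (rule bexI)
  ultimately show ?thesis
    using assms unfolding obstructions_def by (elim insertE emptyE) simp_all
qed

text \<open>The exponents belong to \<open>x2, z, w, v, u, x1\<close> in this order; the bound is
  \<open>M\<close> for long roots and \<open>N\<close> for short ones.\<close>

definition exps :: "(nat \<times> nat \<times> nat \<times> nat \<times> nat \<times> nat) set" where
  "exps = {..<M} \<times> {..<N} \<times> {..<M} \<times> {..<N} \<times> {..<M} \<times> {..<N}"

definition nrm :: "bool list set" where
  "nrm = (\<lambda>(a, b, c, d, e, f). npw a b c d e f) ` exps"

lemma reducible:
  assumes "ws \<notin> nrm"
  shows "\<exists>a l b f. ws = a @ l @ b \<and> f \<in> nid \<and> lead f l"
proof -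
  have *: ?thesis if "factor l ws" "f \<in> nid" "lead f l" for l f
  proof -
    from that(1) obtain a b where "ws = a @ l @ b"
      unfolding factor_def by blast
    with that(2,3) show ?thesis
      by blast
  qed
  show ?thesis
  proof (cases "ofree ws")
    case False
    then obtain l where l: "l \<in> obstructions" "factor l ws"
      unfolding ofree_def by blast
    from lead_obstructions[OF l(1)] obtain g where "g \<in> nid" "lead g l" ..
    then show ?thesis
      using * l(2) by blast
  next
    case True
    then obtain a b c d e f where ws: "ws = npw a b c d e f"
      using ofree_npw by blast
    have "(a, b, c, d, e, f) \<notin> exps"
    proof
      assume "(a, b, c, d, e, f) \<in> exps"
      then have "ws \<in> nrm"
        unfolding nrm_def by (rule image_eqI[rotated]) (simp add: ws)
      with assms show False ..
    qed
    then have "M \<le> a \<or> N \<le> b \<or> M \<le> c \<or> N \<le> d \<or> M \<le> e \<or> N \<le> f"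
      unfolding exps_def by (simp add: not_less)
    then show ?thesis
    proof (elim disjE)
      assume "M \<le> a"
      then show ?thesis
        by (intro *[OF _ x2_M lead_power[OF lead_x(2)], folded rep_def]) (unfold ws, rule factor_npw(1))
    next
      assume "N \<le> b"
      then show ?thesis
        by (intro *[OF _ z_N lead_power[OF lead_z], folded rep_def]) (unfold ws, rule factor_npw(2))
    next
      assume "M \<le> c"
      then show ?thesis
        by (intro *[OF _ w_M lead_power[OF lead_w], folded rep_def]) (unfold ws, rule factor_npw(3))
    next
      assume "N \<le> d"
      then show ?thesis
        by (intro *[OF _ v_N lead_power[OF lead_v], folded rep_def]) (unfold ws, rule factor_npw(4))
    next
      assume "M \<le> e"
      then show ?thesis
        by (intro *[OF _ u_M lead_power[OF lead_u], folded rep_def]) (unfold ws, rule factor_npw(5))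
    next
      assume "N \<le> f"
      then show ?thesis
        by (intro *[OF _ x1_N lead_power[OF lead_x(1)], folded rep_def]) (unfold ws, rule factor_npw(6))
    qed
  qed
qed

end

section \<open>Linear independence of the PBW monomials\<close>

lemma scl_power: "scl c f ^ n = scl (c ^ n) (f ^ n)"
  by (induction n) (simp_all add: mult.commute)

context braiding
begin

text \<open>The Leibniz rule is demanded only on \<open>K\<close> and modulo the ideal, which is all
  that composites satisfy. Commutation with twists up to a scalar makes the kernel stable under
  twists.\<close>

definition skew :: "('a ncser \<Rightarrow> 'a ncser) \<Rightarrow> ('a ncser \<Rightarrow> 'a ncser) \<Rightarrow> 'a ncser set \<Rightarrow> bool" where
  "skew D \<tau> K \<longleftrightarrow> (\<forall>f g. D (f + g) = D f + D g) \<and> (\<forall>c f. D (scl c f) = scl c (D f))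
     \<and> (\<forall>f\<in>nid. D f \<in> nid) \<and> (\<forall>i. \<exists>c. \<forall>f. D (tw i f) = scl c (tw i (D f))) \<and> D 1 \<in> nid
     \<and> (\<forall>f\<in>K. \<forall>g\<in>K. D (f * g) - (f * D g + D f * \<tau> g) \<in> nid)"

definition subalg :: "'a ncser set \<Rightarrow> bool" where
  "subalg K \<longleftrightarrow> 1 \<in> K \<and> (\<forall>f\<in>K. \<forall>g\<in>K. f + g \<in> K \<and> f * g \<in> K) \<and> (\<forall>f\<in>K. \<forall>c. scl c f \<in> K)
     \<and> (\<forall>f\<in>K. \<forall>i. tw i f \<in> K)"

lemma skewD:
  assumes "skew D \<tau> K"
  shows "D (f + g) = D f + D g" "D (scl c f) = scl c (D f)" "f \<in> nid \<Longrightarrow> D f \<in> nid"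
    "D 1 \<in> nid" "f \<in> K \<Longrightarrow> g \<in> K \<Longrightarrow> D (f * g) - (f * D g + D f * \<tau> g) \<in> nid"
    "D 0 = 0" "\<exists>c. \<forall>f. D (tw i f) = scl c (tw i (D f))"
proof -
  show "D 0 = 0"
    using assms unfolding skew_def by (metis scl_0)
qed (use assms in \<open>auto simp: skew_def\<close>)

lemma skew_sum: "skew D \<tau> K \<Longrightarrow> D (sum f A) = (\<Sum>x\<in>A. D (f x))"
  by (induction A rule: infinite_finite_induct) (simp_all add: skewD)

lemma skew_diff: "skew D \<tau> K \<Longrightarrow> D (f - g) = D f - D g"
  using skewD(1)[of D \<tau> K "f - g" g] by (simp add: algebra_simps)

lemma skew_tw_nid: "skew D \<tau> K \<Longrightarrow> D f \<in> nid \<Longrightarrow> D (tw i f) \<in> nid"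
  using skewD(7)[of D \<tau> K i] by (metis nid_scl nid_tw)

lemma subalg_closed:
  assumes "subalg K"
  shows "1 \<in> K" "0 \<in> K" "f \<in> K \<Longrightarrow> g \<in> K \<Longrightarrow> f + g \<in> K" "f \<in> K \<Longrightarrow> g \<in> K \<Longrightarrow> f * g \<in> K"
    "f \<in> K \<Longrightarrow> scl c f \<in> K" "f \<in> K \<Longrightarrow> tw i f \<in> K" "f \<in> K \<Longrightarrow> f ^ n \<in> K"
    "(\<And>x. x \<in> A \<Longrightarrow> F x \<in> K) \<Longrightarrow> sum F A \<in> K"
proof -
  show z: "0 \<in> K"
    using assms unfolding subalg_def by (metis scl_0(1))
  show "f ^ n \<in> K" if "f \<in> K"
    using that assms by (induction n) (auto simp: subalg_def)
  show "sum F A \<in> K" if "\<And>x. x \<in> A \<Longrightarrow> F x \<in> K"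
    using that
  proof (induction A rule: infinite_finite_induct)
    case (insert x A)
    then show ?case
      using assms by (auto simp: subalg_def)
  qed (simp_all add: z)
qed (use assms in \<open>auto simp: subalg_def\<close>)

lemma subalg_UNIV: "subalg UNIV"
  by (simp add: subalg_def)

lemma subalg_ker:
  assumes K: "subalg K" and D: "skew D \<tau> K"
  shows "subalg {f \<in> K. D f \<in> nid}"
  unfolding subalg_def
proof (intro conjI ballI allI CollectI)
  fix f g
  assume f: "f \<in> {f \<in> K. D f \<in> nid}" and g: "g \<in> {f \<in> K. D f \<in> nid}"
  have "f * D g + D f * \<tau> g \<in> nid"
    using f g by (simp add: nid_add nid_mult)
  then show "D (f * g) \<in> nid"
    using nid_cong[OF skewD(5)[OF D, of f g]] f g by simp
qed (use subalg_closed[OF K] skewD[OF D] skew_tw_nid[OF D] nid_closed in auto)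

lemma skew_sd: "skew (sd i) (tw i) UNIV"
  unfolding skew_def by (auto simp: nid_sd sd_tw sd_mult)

text \<open>If the elements of K are constants for D, then D passes through them, so that composing with D
  preserves the Leibniz rule on K.\<close>
lemma skew_comp:
  assumes d: "skew d \<sigma> L" and D: "skew D \<tau> K'" and KL: "K \<subseteq> L"
    and f: "\<And>f. f \<in> K \<Longrightarrow> f \<in> K' \<and> D f \<in> nid \<and> d f \<in> K'"
    and g: "\<And>g. g \<in> K \<Longrightarrow> \<sigma> g \<in> K' \<and> D (\<sigma> g) \<in> nid"
  shows "skew (\<lambda>f. D (d f)) (\<lambda>f. \<tau> (\<sigma> f)) K"
  unfolding skew_def
proof (intro conjI allI ballI)
  fix a b
  assume a: "a \<in> K" and b: "b \<in> K"
  have "D (d (a * b)) - D (a * d b + d a * \<sigma> b) \<in> nid"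
    using skewD(3)[OF D skewD(5)[OF d, of a b]] a b KL by (auto simp: skew_diff[OF D])
  moreover have "D (a * d b) - (a * D (d b) + D a * \<tau> (d b)) \<in> nid"
    using skewD(5)[OF D, of a "d b"] a b f by blast
  moreover have "D (d a * \<sigma> b) - (d a * D (\<sigma> b) + D (d a) * \<tau> (\<sigma> b)) \<in> nid"
    using skewD(5)[OF D, of "d a" "\<sigma> b"] a b f g by blast
  moreover have "D a * \<tau> (d b) \<in> nid" "d a * D (\<sigma> b) \<in> nid"
    using a b f g by (simp_all add: nid_mult)
  ultimately have "(D (d (a * b)) - D (a * d b + d a * \<sigma> b))
      + (D (a * d b) - (a * D (d b) + D a * \<tau> (d b)))
      + (D (d a * \<sigma> b) - (d a * D (\<sigma> b) + D (d a) * \<tau> (\<sigma> b)))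
      + D a * \<tau> (d b) + d a * D (\<sigma> b) \<in> nid"
    by (intro nid_add)
  then show "D (d (a * b)) - (a * D (d b) + D (d a) * \<tau> (\<sigma> b)) \<in> nid"
    by (simp add: skewD(1)[OF D] algebra_simps)
next
  fix i
  obtain c c' where "\<forall>f. D (tw i f) = scl c (tw i (D f))" "\<forall>f. d (tw i f) = scl c' (tw i (d f))"
    using skewD(7)[OF D] skewD(7)[OF d] by blast
  then have "\<forall>f. D (d (tw i f)) = scl (c' * c) (tw i (D (d f)))"
    by (simp add: skewD(2)[OF D])
  then show "\<exists>c. \<forall>f. D (d (tw i f)) = scl c (tw i (D (d f)))" ..
qed (use skewD(1-4)[OF D] skewD(1-4)[OF d] in auto)

text \<open>\<open>D\<close> kills the coefficients and lowers every power of \<open>y\<close> by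
  one, which gives a shorter relation with coefficients rescaled by nonzero scalars. Once the higher
  coefficients are in the ideal, \<open>h 0\<close> is what remains of the sum.\<close>

lemma peel:
  assumes D: "skew D \<tau> K"
    and H: "\<And>h c. h \<in> H \<Longrightarrow> scl c h \<in> H" "\<And>h. h \<in> H \<Longrightarrow> D h \<in> nid"
    and y: "\<And>h j. h \<in> H \<Longrightarrow> D (h * y ^ Suc j) - scl (\<kappa> (Suc j)) (h * y ^ j) \<in> nid"
    and \<kappa>: "\<And>j. 0 < j \<Longrightarrow> j < n \<Longrightarrow> \<kappa> j \<noteq> 0"
    and h: "\<And>j. j < n \<Longrightarrow> h j \<in> H" and sum: "(\<Sum>j<n. h j * y ^ j) \<in> nid"
  shows "j < n \<Longrightarrow> h j \<in> nid"
  using \<kappa> h sum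
proof (induction n arbitrary: h j)
  case (Suc n)
  have eq: "(\<Sum>j<Suc n. h j * y ^ j) = h 0 + (\<Sum>j<n. h (Suc j) * y ^ Suc j)"
    by (subst sum.lessThan_Suc_shift) simp
  have D0: "D (h 0 + (\<Sum>j<n. h (Suc j) * y ^ Suc j)) \<in> nid"
    using skewD(3)[OF D Suc.prems(4)] unfolding eq .
  have eq2: "D (h 0 + (\<Sum>j<n. h (Suc j) * y ^ Suc j)) - (\<Sum>j<n. scl (\<kappa> (Suc j)) (h (Suc j)) * y ^ j)
     = D (h 0) + (\<Sum>j<n. D (h (Suc j) * y ^ Suc j) - scl (\<kappa> (Suc j)) (h (Suc j) * y ^ j))"
    by (simp add: skewD(1)[OF D] skew_sum[OF D] sum_subtractf)
  have "D (h 0) + (\<Sum>j<n. D (h (Suc j) * y ^ Suc j) - scl (\<kappa> (Suc j)) (h (Suc j) * y ^ j)) \<in> nid"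
    by (intro nid_add nid_sum H(2) y Suc.prems(3)) simp_all
  then have "(\<Sum>j<n. scl (\<kappa> (Suc j)) (h (Suc j)) * y ^ j) \<in> nid"
    unfolding eq2[symmetric] using nid_cong D0 by blast
  then have *: "scl (\<kappa> (Suc j)) (h (Suc j)) \<in> nid" if "j < n" for j
    using Suc.IH[of j "\<lambda>j. scl (\<kappa> (Suc j)) (h (Suc j))"] that Suc.prems(2,3) H(1) by simp
  have **: "h (Suc j) \<in> nid" if "j < n" for j
    using *[OF that] Suc.prems(2)[of "Suc j"] that nid_scl_iff by auto
  then have "(\<Sum>j<n. h (Suc j) * y ^ Suc j) \<in> nid"
    by (intro nid_sum nid_mult_left) simp
  then have "h 0 \<in> nid"
    using nid_diff[OF Suc.prems(4)] unfolding eq by fastforce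
  then show ?case
    using ** Suc.prems(1) by (cases j) simp_all
qed simp

text \<open>Here \<open>\<kappa> n\<close> is \<open>c\<close> times the quantum integer 1 + x + ...
  + x^(n-1), nonzero for positive indices below the order of \<open>x\<close>.\<close>

lemma peel_skew:
  assumes D: "skew D \<tau> K" and K: "subalg K"
    and yK: "y \<in> K" and Dy: "D y - scl c 1 \<in> nid" and c: "c \<noteq> 0"
    and \<tau>: "\<And>n. \<tau> (y ^ n) = scl (x ^ n) (y ^ n)"
    and x: "x \<noteq> 1" "\<And>k. 0 < k \<Longrightarrow> k < n \<Longrightarrow> x ^ k \<noteq> 1"
    and h: "\<And>j. j < n \<Longrightarrow> h j \<in> K" "\<And>j. j < n \<Longrightarrow> D (h j) \<in> nid"
    and sum: "(\<Sum>j<n. h j * y ^ j) \<in> nid" and j: "j < n"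
  shows "h j \<in> nid"
proof -
  define \<kappa> where "\<kappa> n = c * (\<Sum>k<n. x ^ k)" for n
  have pow: "D (y ^ Suc j) - scl (\<kappa> (Suc j)) (y ^ j) \<in> nid" for j
  proof (induction j)
    case 0
    then show ?case
      using Dy by (simp add: \<kappa>_def)
  next
    case (Suc j)
    define Y where "Y = y ^ Suc j"
    have Y: "y * y ^ j = Y" "\<tau> Y = scl (x ^ Suc j) Y" "y ^ Suc (Suc j) = y * Y"
      using \<tau>[of "Suc j"] by (simp_all add: Y_def)
    have "\<kappa> (Suc (Suc j)) = \<kappa> (Suc j) + c * x ^ Suc j"
      by (simp add: \<kappa>_def distrib_left)
    then have "D (y ^ Suc (Suc j)) - scl (\<kappa> (Suc (Suc j))) (y ^ Suc j)
      = (D (y * Y) - (y * D Y + D y * \<tau> Y)) + y * (D Y - scl (\<kappa> (Suc j)) (y ^ j))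
        + (D y - scl c 1) * \<tau> Y"
      unfolding Y(2,3) Y_def[symmetric]
      by (simp add: Y(1) left_diff_distrib right_diff_distrib scl_add_left scl_diff mult.commute[of c])
    also have "\<dots> \<in> nid"
    proof (intro nid_add)
      show "D (y * Y) - (y * D Y + D y * \<tau> Y) \<in> nid"
        unfolding Y_def using skewD(5)[OF D yK subalg_closed(7)[OF K yK]] .
      show "y * (D Y - scl (\<kappa> (Suc j)) (y ^ j)) \<in> nid"
        unfolding Y_def by (intro nid_mult_right Suc)
      show "(D y - scl c 1) * \<tau> Y \<in> nid"
        by (intro nid_mult_left Dy)
    qed
    finally show ?case .
  qed
  show ?thesis
  proof (rule peel[where H = "{f \<in> K. D f \<in> nid}" and y = y and \<kappa> = \<kappa>, OF D _ _ _ _ _ sum j])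
    fix j
    assume "0 < j" "j < n"
    have "(x - 1) * (\<Sum>k<j. x ^ k) = x ^ j - 1"
      by (simp add: power_diff_1_eq)
    then have "(\<Sum>k<j. x ^ k) \<noteq> 0"
      using x(2)[OF \<open>0 < j\<close> \<open>j < n\<close>] by auto
    then show "\<kappa> j \<noteq> 0"
      using c by (simp add: \<kappa>_def)
  next
    fix h j
    assume h: "h \<in> {f \<in> K. D f \<in> nid}"
    have "D (h * y ^ Suc j) - (h * D (y ^ Suc j) + D h * \<tau> (y ^ Suc j)) \<in> nid"
      using h by (intro skewD(5)[OF D] subalg_closed(7)[OF K yK]) simp
    moreover have "h * (D (y ^ Suc j) - scl (\<kappa> (Suc j)) (y ^ j)) \<in> nid"
      by (intro nid_mult_right pow)
    moreover have "D h * \<tau> (y ^ Suc j) \<in> nid"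
      using h by (simp add: nid_mult_left)
    ultimately have "D (h * y ^ Suc j) - (h * D (y ^ Suc j) + D h * \<tau> (y ^ Suc j))
       + h * (D (y ^ Suc j) - scl (\<kappa> (Suc j)) (y ^ j)) + D h * \<tau> (y ^ Suc j) \<in> nid"
      by (intro nid_add)
    then show "D (h * y ^ Suc j) - scl (\<kappa> (Suc j)) (h * y ^ j) \<in> nid"
      by (simp add: right_diff_distrib)
  qed (use h subalg_closed[OF K] skewD[OF D] nid_scl in auto)
qed

end

context braiding_G2_order
begin

text \<open>Each operator lowers the degree by that of its root vector, which it therefore sends to
  a scalar modulo the ideal: the degree of \<open>v\<close> is that of \<open>z\<close> plus that of
  \<open>x1\<close>, that of \<open>w\<close> is the sum for \<open>z\<close> and \<open>v\<close>,
  and that of \<open>u\<close> is the sum for \<open>v\<close> and \<open>x1\<close>.\<close>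

definition "Ez f = sd True (sd False f)"
definition "Dv f = Ez (sd False f)"
definition "Dw f = Ez (Dv f)"
definition "Du f = Dv (sd False f)"
definition "\<tau>z f = tw True (tw False f)"
definition "\<tau>v f = \<tau>z (tw False f)"
definition "\<tau>w f = \<tau>z (\<tau>v f)"
definition "\<tau>u f = \<tau>v (tw False f)"
definition "K1 = {f \<in> UNIV. sd True f \<in> nid}"
definition "H1 = {f \<in> K1. Ez f \<in> nid}"
text \<open>The condition puts \<open>Dv f\<close> into \<open>K1\<close>, where \<open>Ez\<close>
  is skew, without requiring \<open>Dv f\<close> to vanish: \<open>w\<close> must belong to
  \<open>P\<close>, and \<open>Dv w\<close> is a nonzero multiple of \<open>z\<close>.\<close>

definition "P = {f \<in> H1. sd True (Dv f) \<in> nid}"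
definition "K4 = {f \<in> H1. Dv f \<in> nid}"

lemma subalg_K1: "subalg K1"
  unfolding K1_def using subalg_ker[OF subalg_UNIV skew_sd] .

lemma skew_Ez: "skew Ez \<tau>z K1"
  unfolding Ez_def[abs_def] \<tau>z_def[abs_def]
  by (rule skew_comp[OF skew_sd skew_sd]) (auto simp: K1_def sd_tw nid_scl nid_tw)

lemma subalg_H1: "subalg H1"
  unfolding H1_def using subalg_ker[OF subalg_K1 skew_Ez] .

lemma skew_Dv: "skew Dv \<tau>v H1"
  unfolding Dv_def[abs_def] \<tau>v_def[abs_def]
  by (rule skew_comp[OF skew_sd skew_Ez])
    (auto simp: H1_def subalg_closed[OF subalg_K1] skew_tw_nid[OF skew_Ez], auto simp: Ez_def K1_def)

lemma \<tau>_subalg: "subalg K \<Longrightarrow> f \<in> K \<Longrightarrow> \<tau>z f \<in> K" "subalg K \<Longrightarrow> f \<in> K \<Longrightarrow> \<tau>v f \<in> K"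
  by (simp_all add: \<tau>z_def \<tau>v_def subalg_closed(6))

lemma skew_sd_Dv: "skew (\<lambda>f. sd True (Dv f)) (\<lambda>f. tw True (\<tau>v f)) H1"
  by (rule skew_comp[OF skew_Dv skew_sd]) (use \<tau>_subalg[OF subalg_H1] in \<open>auto simp: H1_def K1_def\<close>)

lemma subalg_P: "subalg P"
  unfolding P_def using subalg_ker[OF subalg_H1 skew_sd_Dv] .

lemma skew_Dw: "skew Dw \<tau>w P"
  unfolding Dw_def[abs_def] \<tau>w_def[abs_def]
  by (rule skew_comp[OF skew_Dv skew_Ez])
   (use \<tau>_subalg[OF subalg_H1] in \<open>auto simp: P_def H1_def\<close>, auto simp: K1_def)

lemma subalg_K4: "subalg K4"
  unfolding K4_def using subalg_ker[OF subalg_H1 skew_Dv] .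

lemma skew_Du: "skew Du \<tau>u K4"
  unfolding Du_def[abs_def] \<tau>u_def[abs_def]
  by (rule skew_comp[OF skew_sd skew_Dv])
    (auto simp: K4_def subalg_closed[OF subalg_H1] skew_tw_nid[OF skew_Dv],
     auto simp: H1_def K1_def Dv_def Ez_def)

lemma Ez_values: "Ez x1 = 0" "Ez u = 0" "Ez v = 0" "Ez z = scl cz 1" "Ez w \<in> nid"
  by (simp_all add: Ez_def sd_False_u sd_False_v sd_False_z sd_False_w sd_mult nid_scl nid_sd Rvx)

lemma Ez_linear [simp]: "Ez (f + g) = Ez f + Ez g" "Ez (scl c f) = scl c (Ez f)" "Ez 0 = 0" "Ez 1 = 0"
  by (simp_all add: Ez_def)

lemma Dv_values: "Dv x1 = 0" "Dv u = 0" "Dv v = scl (cv * cz) 1"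
  "Dv w - scl (cw * cz * (1 + q)) z \<in> nid"
proof -
  have "Ez (z * z) = scl (cz * (1 + q)) z"
  proof (rule ncser_eqI)
    fix a
    show "cf (Ez (z * z)) a = cf (scl (cz * (1 + q)) z) a"
      unfolding Ez_def sd_mult sd_False_z sd_linear sd_True_z tw_False_z tw_x tw_True_z sd_x ncs
        mult_zero_right mult_zero_left add_0_left add_0_right scl_0 cf_simps
      using qt rR by algebra
  qed
  then have "Dv w - scl (cw * cz * (1 + q)) z = scl cz (Ez Rvx)"
    by (simp add: Dv_def sd_False_w ac_simps)
  then show "Dv w - scl (cw * cz * (1 + q)) z \<in> nid"
    by (simp add: Ez_def nid_scl nid_sd Rvx)
qed (simp_all add: Dv_def sd_False_u sd_False_v Ez_values)

lemma sd_Dv_w: "sd True (Dv w) \<in> nid"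
  using nid_sd[OF Dv_values(4), of True] by simp

lemma Dw_values: "Dw x1 = 0" "Dw u = 0" "Dw v = 0" "Dw w - scl (cw * cz * (1 + q) * cz) 1 \<in> nid"
proof -
  have "Ez (Dv w - scl (cw * cz * (1 + q)) z) \<in> nid"
    using skewD(3)[OF skew_Ez Dv_values(4)] .
  then show "Dw w - scl (cw * cz * (1 + q) * cz) 1 \<in> nid"
    by (simp add: Dw_def skew_diff[OF skew_Ez] Ez_values)
qed (simp_all add: Dw_def Dv_values)

lemma Du_values: "Du x1 = 0" "Du u = scl (cu * (cv * cz)) 1"
proof -
  have "Dv 1 = 0"
    by (simp add: Dv_def)
  then show "Du x1 = 0"
    by (simp add: Du_def)
  show "Du u = scl (cu * (cv * cz)) 1"
    by (simp add: Du_def sd_False_u skewD(2)[OF skew_Dv] Dv_values)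
qed

lemma in_H1: "x1 \<in> H1" "u \<in> H1" "v \<in> H1" "w \<in> H1"
  by (simp_all add: H1_def K1_def Ez_values)

lemma in_P: "x1 \<in> P" "u \<in> P" "v \<in> P" "w \<in> P"
  by (simp_all add: P_def in_H1 Dv_values sd_Dv_w)

lemma in_K4: "x1 \<in> K4" "u \<in> K4"
  by (simp_all add: K4_def in_H1 Dv_values)

lemma tw_True_v: "tw True v = scl (r ^ 2 * q ^ 3) v"
  by (simp add: v_def scl_distribs power2_eq_square ac_simps)

lemma tw_True_u: "tw True u = scl (r ^ 3 * q ^ 3) u"
  by (simp add: u_def tw_True_v scl_distribs power2_eq_square power3_eq_cube ac_simps)

lemma tw_True_w: "tw True w = scl (r ^ 3 * q ^ 6) w"
proof (rule ncser_eqI)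
  fix a
  show "cf (tw True w) a = cf (scl (r ^ 3 * q ^ 6) w) a"
    unfolding w_def tw_linear tw_mult tw_True_z tw_True_v ncs cf_simps by algebra
qed

text \<open>The twist of an operator that lowers by the root b multiplies degree d by \<chi>(b,d);
  on its own root vector this is \<chi>(b,b), that is \<open>q\<close> for short and
  \<open>q ^ 3\<close> for long roots.\<close>

lemma \<tau>_values: "\<tau>z (z ^ n) = scl (q ^ n) (z ^ n)" "\<tau>v (v ^ n) = scl (q ^ n) (v ^ n)"
  "\<tau>u (u ^ n) = scl ((q ^ 3) ^ n) (u ^ n)" "\<tau>w (w ^ n) = scl ((q ^ 3) ^ n) (w ^ n)"
proof -
  have pow: "\<tau>z (f ^ n) = \<tau>z f ^ n" "\<tau>v (f ^ n) = \<tau>v f ^ n" "\<tau>u (f ^ n) = \<tau>u f ^ n"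
    "\<tau>w (f ^ n) = \<tau>w f ^ n" for f
    by (simp_all add: \<tau>z_def \<tau>v_def \<tau>u_def \<tau>w_def)
  have "R * t ^ 2 * (r * q ^ 3) = q"
    using qt rR by algebra
  then have "\<tau>z z = scl q z"
    by (simp add: \<tau>z_def)
  then show "\<tau>z (z ^ n) = scl (q ^ n) (z ^ n)"
    by (simp add: pow scl_power)
  have "R * t * (R * t * (r ^ 2 * q ^ 3)) = q"
    using qt rR by algebra
  then have "\<tau>v v = scl q v"
    by (simp add: \<tau>z_def \<tau>v_def tw_True_v mult.assoc)
  then show "\<tau>v (v ^ n) = scl (q ^ n) (v ^ n)"
    by (simp add: pow scl_power)
  have "R * (R * (R * (r ^ 3 * q ^ 3))) = q ^ 3"
    using rR by algebra
  then have "\<tau>u u = scl (q ^ 3) u"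
    by (simp add: \<tau>u_def \<tau>z_def \<tau>v_def tw_True_u mult.assoc)
  then show "\<tau>u (u ^ n) = scl ((q ^ 3) ^ n) (u ^ n)"
    by (simp add: pow scl_power)
  have "R ^ 2 * t ^ 3 * (R ^ 2 * t ^ 3 * (r ^ 3 * q ^ 6 * (R ^ 2 * t ^ 3 * (r ^ 3 * q ^ 6)))) = q ^ 3"
    using qt rR by algebra
  then have "\<tau>w w = scl (q ^ 3) w"
    by (simp add: \<tau>w_def \<tau>z_def \<tau>v_def tw_True_w) (simp add: ac_simps)
  then show "\<tau>w (w ^ n) = scl ((q ^ 3) ^ n) (w ^ n)"
    by (simp add: pow scl_power)
qed

lemma constants_nonzero: "cz \<noteq> 0" "cv \<noteq> 0" "cu \<noteq> 0" "cw \<noteq> 0" "1 + q \<noteq> 0"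
proof -
  show q: "1 + q \<noteq> 0"
    using q_ne(2) by (metis add.commute add_eq_0_iff2)
  show "cz \<noteq> 0" "cv \<noteq> 0" "cw \<noteq> 0"
    using t_ne q nonzero by (auto simp: cz_def cv_def cw_def)
  have "q * (q ^ 2 - t) = q ^ 3 - 1"
    using qt by algebra
  then show "cu \<noteq> 0"
    using q_ne(3) unfolding cu_def by auto
qed

text \<open>The factors are in the order opposite to \<open>npw\<close>, so that the coefficient of
  the vector being stripped stands on its left. Only the number of monomials is compared with the
  number of normal words.\<close>

definition pbw :: "nat \<times> nat \<times> nat \<times> nat \<times> nat \<times> nat \<Rightarrow> 'a ncser" where
  "pbw = (\<lambda>(a, b, c, d, e, f). x1 ^ f * u ^ e * v ^ d * w ^ c * z ^ b * x2 ^ a)"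

text \<open>The sum is regrouped as a polynomial in \<open>x2\<close> whose coefficients are
  polynomials in \<open>z\<close>, and so on through \<open>w, v, u, x1\<close>. Stripping
  \<open>w\<close> before \<open>v\<close> matters: \<open>Dw\<close> kills \<open>v\<close>,
  whereas \<open>Dv\<close> does not kill \<open>w\<close>.\<close>

lemma pbw_independent:
  assumes "(\<Sum>x\<in>exps. scl (C x) (pbw x)) \<in> nid" and "x \<in> exps"
  shows "C x = 0"
proof -
  obtain a b c d e f where x: "x = (a, b, c, d, e, f)"
    by (cases x)
  have lt: "a < M" "b < N" "c < M" "d < N" "e < M" "f < N"
    using assms(2) by (auto simp: x exps_def)
  define A5 where "A5 a b c d e = (\<Sum>f<N. scl (C (a, b, c, d, e, f)) (x1 ^ f))" for a b c d e
  define A4 where "A4 a b c d = (\<Sum>e<M. A5 a b c d e * u ^ e)" for a b c d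
  define A3 where "A3 a b c = (\<Sum>d<N. A4 a b c d * v ^ d)" for a b c
  define A2 where "A2 a b = (\<Sum>c<M. A3 a b c * w ^ c)" for a b
  define A1 where "A1 a = (\<Sum>b<N. A2 a b * z ^ b)" for a
  have "(\<Sum>x\<in>exps. scl (C x) (pbw x)) = (\<Sum>(a, b, c, d, e, f)\<in>exps.
      scl (C (a, b, c, d, e, f)) (x1 ^ f * u ^ e * v ^ d * w ^ c * z ^ b * x2 ^ a))"
    by (intro sum.cong) (auto simp: pbw_def)
  also have "\<dots> = (\<Sum>a<M. A1 a * x2 ^ a)"
    unfolding A1_def A2_def A3_def A4_def A5_def exps_def
    by (simp add: sum.cartesian_product[symmetric] sum_distrib_right)
  finally have s: "(\<Sum>a<M. A1 a * x2 ^ a) \<in> nid"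
    using assms(1) by simp
  have A5: "A5 a b c d e \<in> K" if "subalg K" "x1 \<in> K" for a b c d e K
    unfolding A5_def using that by (intro subalg_closed) auto
  have A4: "A4 a b c d \<in> K" if "subalg K" "x1 \<in> K" "u \<in> K" for a b c d K
    unfolding A4_def using that A5 by (intro subalg_closed) auto
  have A3: "A3 a b c \<in> K" if "subalg K" "x1 \<in> K" "u \<in> K" "v \<in> K" for a b c K
    unfolding A3_def using that A4 by (intro subalg_closed) auto
  have A2: "A2 a b \<in> K" if "subalg K" "x1 \<in> K" "u \<in> K" "v \<in> K" "w \<in> K" for a b K
    unfolding A2_def using that A3 by (intro subalg_closed) auto
  have A1: "A1 a \<in> K" if "subalg K" "x1 \<in> K" "u \<in> K" "v \<in> K" "w \<in> K" "z \<in> K" for a K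
    unfolding A1_def using that A2 by (intro subalg_closed) auto
  have N': "\<And>k. 0 < k \<Longrightarrow> k < N \<Longrightarrow> q ^ k \<noteq> 1" and M': "\<And>k. 0 < k \<Longrightarrow> k < M \<Longrightarrow> (q ^ 3) ^ k \<noteq> 1"
    using N(3) M(3) by blast+
  have 1: "A1 a \<in> nid"
  proof (rule peel_skew[OF skew_sd[of True] subalg_UNIV,
      where c = 1 and x = "q ^ 3" and y = x2 and h = A1,
      OF _ _ _ _ q_ne(3) M' _ _ s lt(1)])
    show "sd True (A1 j) \<in> nid" for j
      using A1[OF subalg_K1, of j] by (simp add: K1_def)
  qed (simp_all add: scl_power)
  have 2: "A2 a b \<in> nid"
  proof (rule peel_skew[OF skew_Ez subalg_K1,
      where c = cz and x = q and y = z and h = "A2 a",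
      OF _ _ _ _ q_ne(1) N' _ _ _ lt(2)])
    show "(\<Sum>b<N. A2 a b * z ^ b) \<in> nid"
      using 1 by (simp add: A1_def)
    have "A2 a j \<in> H1" for j
      by (rule A2[OF subalg_H1]) (fact in_H1)+
    then show "A2 a j \<in> K1" "Ez (A2 a j) \<in> nid" for j
      by (simp_all add: H1_def)
  qed (simp_all add: \<tau>_values constants_nonzero Ez_values, simp add: K1_def)
  have 3: "A3 a b c \<in> nid"
  proof (rule peel_skew[OF skew_Dw subalg_P,
      where c = "cw * cz * (1 + q) * cz" and x = "q ^ 3" and y = w and h = "A3 a b",
      OF _ _ _ _ q_ne(3) M' _ _ _ lt(3)])
    show "(\<Sum>c<M. A3 a b c * w ^ c) \<in> nid"
      using 2 by (simp add: A2_def)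
    show "A3 a b j \<in> P" for j
      by (rule A3[OF subalg_P]) (fact in_P)+
    have "A3 a b j \<in> {f \<in> P. Dw f \<in> nid}" for j
      by (rule A3[OF subalg_ker[OF subalg_P skew_Dw]]) (simp_all add: in_P Dw_values)
    then show "Dw (A3 a b j) \<in> nid" for j
      by simp
  qed (simp_all add: \<tau>_values constants_nonzero Dw_values in_P)
  have 4: "A4 a b c d \<in> nid"
  proof (rule peel_skew[OF skew_Dv subalg_H1,
      where c = "cv * cz" and x = q and y = v and h = "A4 a b c",
      OF _ _ _ _ q_ne(1) N' _ _ _ lt(4)])
    show "(\<Sum>d<N. A4 a b c d * v ^ d) \<in> nid"
      using 3 by (simp add: A3_def)
    have "A4 a b c j \<in> K4" for j
      by (rule A4[OF subalg_K4]) (fact in_K4)+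
    then show "A4 a b c j \<in> H1" "Dv (A4 a b c j) \<in> nid" for j
      by (simp_all add: K4_def)
  qed (simp_all add: \<tau>_values constants_nonzero Dv_values in_H1)
  have 5: "A5 a b c d e \<in> nid"
  proof (rule peel_skew[OF skew_Du subalg_K4,
      where c = "cu * (cv * cz)" and x = "q ^ 3" and y = u and h = "A5 a b c d",
      OF _ _ _ _ q_ne(3) M' _ _ _ lt(5)])
    show "(\<Sum>e<M. A5 a b c d e * u ^ e) \<in> nid"
      using 4 by (simp add: A4_def)
    show "A5 a b c d j \<in> K4" for j
      by (rule A5[OF subalg_K4]) (fact in_K4)
    have "A5 a b c d j \<in> {f \<in> K4. Du f \<in> nid}" for j
      by (rule A5[OF subalg_ker[OF subalg_K4 skew_Du]]) (simp add: in_K4 Du_values)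
    then show "Du (A5 a b c d j) \<in> nid" for j
      by simp
  qed (simp_all add: \<tau>_values constants_nonzero Du_values in_K4)
  have "scl (C (a, b, c, d, e, f)) 1 \<in> nid"
  proof (rule peel_skew[OF skew_sd[of False] subalg_UNIV, where c = 1 and x = q and y = x1
        and h = "\<lambda>f. scl (C (a, b, c, d, e, f)) 1", OF _ _ _ _ q_ne(1) N' _ _ _ lt(6)])
    show "(\<Sum>f<N. scl (C (a, b, c, d, e, f)) 1 * x1 ^ f) \<in> nid"
      using 5 by (simp add: A5_def)
  qed (simp_all add: scl_power)
  then show ?thesis
    by (simp add: nid_iff[of "scl _ _"] x)
qed

end

section \<open>Iterated brackets span the augmentation ideal\<close>

definition deg :: "bool list \<Rightarrow> nat \<times> nat" where
  "deg w = (count_list w False, count_list w True)"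

lemma deg_append: "deg (u @ v) = (fst (deg u) + fst (deg v), snd (deg u) + snd (deg v))"
  by (simp add: deg_def)

context braiding
begin

lemma chiw_deg:
  assumes "deg a = deg a'" "deg b = deg b'"
  shows "chiw qm a b = chiw qm a' b'"
proof -
  have 1: "chiw qm [i] b = qm i False ^ fst (deg b) * qm i True ^ snd (deg b)" for i b
  proof (induction b)
    case (Cons j b)
    have "chiw qm [i] (j # b) = qm i j * chiw qm [i] b"
      using chiw_Cons_right[of "[i]" j b] by simp
    then show ?case
      unfolding Cons by (cases j) (simp_all add: deg_def)
  qed (simp add: deg_def)
  have "chiw qm a b = chiw qm [False] b ^ fst (deg a) * chiw qm [True] b ^ snd (deg a)" for a b
  proof (induction a)
    case (Cons i a)
    have "chiw qm (i # a) b = chiw qm [i] b * chiw qm a b"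
      by (rule chiw_Cons_left)
    then show ?case
      unfolding Cons by (cases i) (simp_all add: deg_def)
  qed (simp add: deg_def)
  then show ?thesis
    using assms 1 by simp
qed

definition bev :: "brk \<Rightarrow> 'a ncser" where
  "bev t = NC (brk_eval qm t)"

lemma bev_simps: "bev (Gen i) = wd [i]"
  "bev (Brk s t) = bev t * bev s - scl (chiw qm (leaves t) (leaves s)) (bev s * bev t)"
  by (simp_all add: bev_def wd_def times_ncser_def minus_ncser_def scl_def)

definition brkspan :: "nat \<times> nat \<Rightarrow> 'a ncser set" where
  "brkspan d = ncv.span (bev ` {t. deg (leaves t) = d})"

text \<open>The degree is retained because the scalar in a bracket depends on it.\<close>

definition brkmod :: "nat \<times> nat \<Rightarrow> 'a ncser set" where
  "brkmod d = {f. \<exists>g\<in>brkspan d. f - g \<in> nid}"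

text \<open>All brackets of one degree share the same scalar, so bracketing is bilinear on graded
  pieces; it is extended from brackets to their span first in \<open>f\<close>, then in
  \<open>g\<close>.\<close>

lemma brkspan_bracket:
  assumes f: "f \<in> brkspan (deg a)" and g: "g \<in> brkspan (deg b)"
  shows "g * f - scl (chiw qm b a) (f * g) \<in> brkspan (deg (a @ b))"
proof -
  let ?S = "\<lambda>g. {f. g * f - scl (chiw qm b a) (f * g) \<in> brkspan (deg (a @ b))}"
  let ?S' = "{g. g * f - scl (chiw qm b a) (f * g) \<in> brkspan (deg (a @ b))}"
  have sub: "ncv.subspace (?S g)" for g
  proof (rule ncv.subspaceI)
    fix x y c
    assume "x \<in> ?S g" "y \<in> ?S g"
    then have "(g * x - scl (chiw qm b a) (x * g)) + (g * y - scl (chiw qm b a) (y * g)) \<in> brkspan (deg (a @ b))"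
      unfolding brkspan_def by (intro ncv.span_add) simp_all
    then show "x + y \<in> ?S g"
      by (simp add: algebra_simps scl_add)
  next
    fix x c
    assume "x \<in> ?S g"
    then have "scl c (g * x - scl (chiw qm b a) (x * g)) \<in> brkspan (deg (a @ b))"
      unfolding brkspan_def by (intro ncv.span_scale) simp_all
    then show "scl c x \<in> ?S g"
      by (simp add: scl_diff mult.commute)
  qed (simp add: brkspan_def ncv.span_zero)
  have sub': "ncv.subspace ?S'"
  proof (rule ncv.subspaceI)
    fix x y c
    assume "x \<in> ?S'" "y \<in> ?S'"
    then have "(x * f - scl (chiw qm b a) (f * x)) + (y * f - scl (chiw qm b a) (f * y)) \<in> brkspan (deg (a @ b))"
      unfolding brkspan_def by (intro ncv.span_add) simp_all
    then show "x + y \<in> ?S'"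
      by (simp add: algebra_simps scl_add)
  next
    fix x c
    assume "x \<in> ?S'"
    then have "scl c (x * f - scl (chiw qm b a) (f * x)) \<in> brkspan (deg (a @ b))"
      unfolding brkspan_def by (intro ncv.span_scale) simp_all
    then show "scl c x \<in> ?S'"
      by (simp add: scl_diff mult.commute)
  qed (simp add: brkspan_def ncv.span_zero)
  have gen: "bev t \<in> ?S'" if t: "deg (leaves t) = deg b" for t
  proof -
    have "bev s \<in> ?S (bev t)" if s: "deg (leaves s) = deg a" for s
    proof -
      have "deg (leaves (Brk s t)) = deg (a @ b)"
        using s t by (simp add: deg_append)
      then have "bev (Brk s t) \<in> brkspan (deg (a @ b))"
        unfolding brkspan_def by (intro ncv.span_base) blast
      moreover have "chiw qm (leaves t) (leaves s) = chiw qm b a"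
        by (rule chiw_deg[OF t s])
      ultimately show ?thesis
        by (simp add: bev_simps)
    qed
    then have "bev ` {s. deg (leaves s) = deg a} \<subseteq> ?S (bev t)"
      by blast
    then have "brkspan (deg a) \<subseteq> ?S (bev t)"
      unfolding brkspan_def[of "deg a"] using sub by (rule ncv.span_minimal)
    then show ?thesis
      using f by blast
  qed
  have "bev ` {t. deg (leaves t) = deg b} \<subseteq> ?S'"
    using gen by blast
  then have "brkspan (deg b) \<subseteq> ?S'"
    unfolding brkspan_def[of "deg b"] using sub' by (rule ncv.span_minimal)
  then show ?thesis
    using g by blast
qed

lemma brkmod_closed:
  "f \<in> nid \<Longrightarrow> f \<in> brkmod d" "f \<in> brkmod d \<Longrightarrow> g \<in> brkmod d \<Longrightarrow> f + g \<in> brkmod d"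
  "f \<in> brkmod d \<Longrightarrow> scl c f \<in> brkmod d"
proof -
  show "f \<in> brkmod d" if "f \<in> nid"
    unfolding brkmod_def using that by (auto simp: brkspan_def intro!: bexI[of _ 0] ncv.span_zero)
  show "f + g \<in> brkmod d" if f: "f \<in> brkmod d" and g: "g \<in> brkmod d"
  proof -
    obtain f' g' where *: "f' \<in> brkspan d" "f - f' \<in> nid" "g' \<in> brkspan d" "g - g' \<in> nid"
      using f g unfolding brkmod_def by blast
    have "(f + g) - (f' + g') = (f - f') + (g - g')"
      by simp
    also have "\<dots> \<in> nid"
      by (intro nid_add *)
    finally show ?thesis
      unfolding brkmod_def using * by (auto simp: brkspan_def intro: ncv.span_add)
  qed
  show "scl c f \<in> brkmod d" if f: "f \<in> brkmod d"
  proof -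
    obtain f' where *: "f' \<in> brkspan d" "f - f' \<in> nid"
      using f unfolding brkmod_def by blast
    have "scl c f - scl c f' \<in> nid"
      using nid_scl[OF *(2), of c] by (simp add: scl_diff)
    then show ?thesis
      unfolding brkmod_def using * by (auto simp: brkspan_def intro: ncv.span_scale)
  qed
qed

definition inL :: "bool list \<Rightarrow> bool" where
  "inL w \<longleftrightarrow> wd w \<in> brkmod (deg w)"

lemma inL_single: "inL [i]"
proof -
  have "bev (Gen i) \<in> brkspan (deg [i])"
    unfolding brkspan_def by (intro ncv.span_base imageI) simp
  then show ?thesis
    unfolding inL_def brkmod_def by (auto simp: bev_simps intro!: bexI[of _ "wd [i]"])
qed

lemma inL_bracket:
  assumes "inL a" "inL b"
  shows "wd (b @ a) - scl (chiw qm b a) (wd (a @ b)) \<in> brkmod (deg (a @ b))"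
proof -
  obtain f g where f: "f \<in> brkspan (deg a)" "wd a - f \<in> nid" and g: "g \<in> brkspan (deg b)" "wd b - g \<in> nid"
    using assms unfolding inL_def brkmod_def by blast
  have ba: "wd (b @ a) - g * f = wd b * (wd a - f) + (wd b - g) * f"
    and ab: "wd (a @ b) - f * g = wd a * (wd b - g) + (wd a - f) * g"
    by (simp_all add: wd_append algebra_simps)
  have nid: "wd (b @ a) - g * f \<in> nid" "wd (a @ b) - f * g \<in> nid"
    unfolding ba ab by (intro nid_add nid_mult_left nid_mult_right f g)+
  have "(wd (b @ a) - g * f) - scl (chiw qm b a) (wd (a @ b) - f * g) \<in> nid"
    by (rule nid_diff[OF nid(1) nid_scl[OF nid(2)]])
  then have "(wd (b @ a) - scl (chiw qm b a) (wd (a @ b))) - (g * f - scl (chiw qm b a) (f * g)) \<in> nid"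
    by (simp add: scl_diff algebra_simps)
  then show ?thesis
    using brkspan_bracket[OF f(1) g(1)] unfolding brkmod_def by blast
qed

lemma deg_commute: "deg (a @ b) = deg (b @ a)"
  by (simp add: deg_append add.commute)

lemma inL_rotate:
  assumes "inL a" "inL b" "inL (a @ b)"
  shows "inL (b @ a)"
proof -
  have "(wd (b @ a) - scl (chiw qm b a) (wd (a @ b))) + scl (chiw qm b a) (wd (a @ b)) \<in> brkmod (deg (a @ b))"
    using assms(3) unfolding inL_def
    by (rule brkmod_closed(2)[OF inL_bracket[OF assms(1,2)] brkmod_closed(3)])
  then show ?thesis
    by (simp add: inL_def deg_commute[of b a])
qed

text \<open>The brackets of \<open>a, b\<close> in both orders are two linear equations for
  \<open>ab\<close> and \<open>ba\<close> with determinant 1 - \<chi>(a,b)\<chi>(b,a).\<close>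

lemma inL_append:
  assumes "inL a" "inL b" "chiw qm a b * chiw qm b a \<noteq> 1"
  shows "inL (a @ b)"
proof -
  have 1: "wd (b @ a) - scl (chiw qm b a) (wd (a @ b)) \<in> brkmod (deg (a @ b))"
    using assms by (intro inL_bracket)
  have 2: "wd (a @ b) - scl (chiw qm a b) (wd (b @ a)) \<in> brkmod (deg (a @ b))"
    using inL_bracket[OF assms(2,1)] by (simp add: deg_commute[of b a])
  let ?c = "1 - chiw qm a b * chiw qm b a"
  have "(wd (a @ b) - scl (chiw qm a b) (wd (b @ a)))
      + scl (chiw qm a b) (wd (b @ a) - scl (chiw qm b a) (wd (a @ b))) \<in> brkmod (deg (a @ b))"
    by (rule brkmod_closed(2)[OF 2 brkmod_closed(3)[OF 1]])
  then have "scl ?c (wd (a @ b)) \<in> brkmod (deg (a @ b))"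
    by (simp add: scl_diff scl_diff_left)
  then have "scl (inverse ?c) (scl ?c (wd (a @ b))) \<in> brkmod (deg (a @ b))"
    by (rule brkmod_closed)
  then show ?thesis
    using assms(3) by (simp add: inL_def)
qed

lemma inL_nid: "wd w \<in> nid \<Longrightarrow> inL w"
  by (simp add: inL_def brkmod_closed)

text \<open>With p = \<open>qm i i\<close>, applying \<open>inL_append\<close> to the n-th power of
  a letter and that letter would need p^(2n) different from 1, which fails halfway when the order is
  even. But both products are the same word, so one bracket already gives it with factor 1 -
  p^n.\<close>

lemma inL_replicate:
  assumes n: "0 < n" and ord: "\<And>k. 0 < k \<Longrightarrow> k < n \<Longrightarrow> qm i i ^ k \<noteq> 1"
  shows "inL (replicate n i)"
  using assms
proof (induction n)
  case (Suc n)
  show ?case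
  proof (cases "n = 0")
    case False
    have "inL (replicate n i)"
      using Suc False by simp
    have chi: "chiw qm [i] (replicate n i) = qm i i ^ n"
      by (induction n) (simp_all add: chiw_Cons_right[of "[i]"])
    have rep: "replicate n i @ [i] = replicate (Suc n) i" "[i] @ replicate n i = replicate (Suc n) i"
      by (simp_all add: replicate_append_same)
    have "scl (1 - qm i i ^ n) (wd (replicate (Suc n) i)) \<in> brkmod (deg (replicate (Suc n) i))"
      using inL_bracket[OF \<open>inL (replicate n i)\<close> inL_single[of i]]
      unfolding rep chi by (simp only: scl_diff_left scl_1)
    then have "scl (inverse (1 - qm i i ^ n)) (scl (1 - qm i i ^ n) (wd (replicate (Suc n) i)))
        \<in> brkmod (deg (replicate (Suc n) i))"
      by (rule brkmod_closed)
    moreover have "qm i i ^ n \<noteq> 1"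
      using Suc.prems(2)[of n] False by simp
    ultimately show ?thesis
      by (simp add: inL_def)
  qed (simp add: inL_single)
qed simp

end

text \<open>A word without the factor \<open>[False, True]\<close> consists of letters
  \<open>True\<close> followed by letters \<open>False\<close>, and then the factor occurs across
  the end of the cyclic word.\<close>

lemma rotate_to_False_True:
  assumes "False \<in> set ws" "True \<in> set ws"
  shows "\<exists>a b c. ws = a @ b \<and> b @ a = [False, True] @ c"
proof (cases "\<exists>a c. ws = a @ [False, True] @ c")
  case True
  then obtain a c where "ws = a @ [False, True] @ c"
    by blast
  then show ?thesis
    by (intro exI[of _ a] exI[of _ "[False, True] @ c"] exI[of _ "c @ a"]) simp
next
  case False
  have "\<exists>m n. ws = replicate m True @ replicate n False"
    using False
  proof (induction ws rule: rev_induct)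
    case (snoc x ws)
    then obtain m n where ws: "ws = replicate m True @ replicate n False"
      by (metis append.assoc)
    show ?case
    proof (cases x)
      case True
      have "n = 0"
      proof (rule ccontr)
        assume "n \<noteq> 0"
        then obtain k where "n = Suc k"
          using not0_implies_Suc by blast
        then have "ws @ [x] = (replicate m True @ replicate k False) @ [False, True] @ []"
          using True by (simp add: ws replicate_append_same[symmetric])
        then show False
          using snoc.prems by blast
      qed
      then have "ws @ [x] = replicate (Suc m) True @ replicate 0 False"
        using True by (simp add: ws replicate_append_same)
      then show ?thesis
        by blast
    next
      case False
      then have "ws @ [x] = replicate m True @ replicate (Suc n) False"
        by (simp add: ws replicate_append_same)
      then show ?thesis
        by blast
    qed
  qed simp
  then obtain m n where ws: "ws = replicate m True @ replicate n False"
    by blast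
  obtain k where k: "n = Suc k"
    using assms(1) by (cases n) (auto simp: ws)
  obtain l where l: "m = Suc l"
    using assms(2) by (cases m) (auto simp: ws)
  have "replicate n False @ replicate m True = replicate k False @ [False, True] @ replicate l True"
    by (simp add: k l replicate_app_Cons_same)
  then have "replicate m True @ replicate n False = (replicate m True @ replicate k False) @ [False]"
    by (simp add: k replicate_append_same)
  then show ?thesis
    by (intro exI[of _ "replicate m True @ replicate k False"] exI[of _ "[False]"]
        exI[of _ "replicate l True @ replicate k False"]) (simp add: ws l)
qed

section \<open>Splitting words with the symmetrized bicharacter\<close>

context braiding_G2_order
begin

definition be :: "bool list \<Rightarrow> bool list \<Rightarrow> 'a" where
  "be a b = chiw qm a b * chiw qm b a"

lemma be_append: "be (a @ b) c = be a c * be b c" "be c (a @ b) = be c a * be c b"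
  by (simp_all add: be_def chiw_append_left chiw_append_right)

lemma be_commute: "be a b = be b a"
  by (simp add: be_def)

lemma be_single: "be [False] [False] = q ^ 2" "be [False] [True] = t ^ 3" "be [True] [False] = t ^ 3"
  "be [True] [True] = q ^ 6"
proof -
  have "t ^ 3 * R * r = t ^ 3" "q ^ 3 * q ^ 3 = q ^ 6" "q * q = q ^ 2" "r * (t ^ 3 * R) = t ^ 3"
    using rR by algebra+
  then show "be [False] [False] = q ^ 2" "be [False] [True] = t ^ 3" "be [True] [False] = t ^ 3"
    "be [True] [True] = q ^ 6"
    by (simp_all add: be_def)
qed

lemma be_FT: "be [False, True] [False, True] = q ^ 2"
proof -
  have "be [False, True] [False, True]
      = (be [False] [False] * be [False] [True]) * (be [True] [False] * be [True] [True])"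
    using be_append(1)[of "[False]" "[True]" "[False, True]"]
    by (simp add: be_append(2)[of _ "[False]" "[True]", simplified])
  also have "\<dots> = q ^ 2"
    unfolding be_single using qt by algebra
  finally show ?thesis .
qed

lemma be_FTF: "be [False, True, False] [False, True, False] = q ^ 2"
proof -
  have "be [False, True, False] [False, True, False]
      = be [False, True] [False, True] * be [False] [False, True] * (be [False] [False, True] * be [False] [False])"
    using be_append(1)[of "[False, True]" "[False]" "[False, True, False]"]
      be_append(2)[of _ "[False, True]" "[False]"] be_commute[of "[False, True]" "[False]"]
    by simp
  also have "be [False] [False, True] = be [False] [False] * be [False] [True]"
    using be_append(2)[of _ "[False]" "[True]"] by simp
  also have "be [False, True] [False, True] * (be [False] [False] * be [False] [True])
      * ((be [False] [False] * be [False] [True]) * be [False] [False]) = q ^ 2"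
    unfolding be_FT be_single using qt by algebra
  finally show ?thesis .
qed

lemma wd_replicate: "wd (replicate n i) = wd [i] ^ n"
  by (induction n) (simp_all add: wd_Nil wd_Cons[of i "replicate _ i"])

lemma nid_power_ge: "f ^ m \<in> nid \<Longrightarrow> m \<le> n \<Longrightarrow> f ^ n \<in> nid"
  using nid_mult_left[of "f ^ m" "f ^ (n - m)"] by (simp flip: power_add)

lemma inL_pure: "0 < n \<Longrightarrow> inL (replicate n i)"
proof (cases "n \<le> (if i then M else N)")
  case True
  assume "0 < n"
  then show ?thesis
    using True N(3) M(3) by (intro inL_replicate) (cases i; simp)+
next
  case False
  have "wd [i] ^ (if i then M else N) \<in> nid"
    using x1_N x2_M by (simp add: x1_def x2_def)
  then have "wd (replicate n i) \<in> nid"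
    using False unfolding wd_replicate by (intro nid_power_ge[of _ "if i then M else N" n]) simp_all
  then show ?thesis
    by (rule inL_nid)
qed

text \<open>By strong induction on the length all proper factors are available, so rotating is free
  and splitting needs only a pairing different from 1.\<close>

lemma inL_nonempty: "ws \<noteq> [] \<Longrightarrow> inL ws"
proof (induction "length ws" arbitrary: ws rule: less_induct)
  case less
  have IH: "inL a" if "a \<noteq> []" "length a < length ws" for a
    using less.hyps[of a] that by blast
  have rot: "inL (a @ b)" if "inL (b @ a)" "length (a @ b) = length ws" for a b
  proof (cases "a = [] \<or> b = []")
    case False
    then have "a \<noteq> []" "b \<noteq> []" "0 < length a" "0 < length b"
      by auto
    moreover from this have "length a < length ws" "length b < length ws"
      using that(2) unfolding length_append by linarith+
    ultimately show ?thesis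
      using inL_rotate[OF IH IH that(1)] by blast
  qed (use that in auto)
  have split: "inL (a @ b)" if "be a b \<noteq> 1" "a \<noteq> []" "b \<noteq> []" "length (a @ b) = length ws" for a b
  proof -
    have "0 < length a" "0 < length b"
      using that by auto
    then have "length a < length ws" "length b < length ws"
      using that(4) unfolding length_append by linarith+
    then show ?thesis
      using inL_append[OF IH IH] that unfolding be_def by blast
  qed
  \<comment> \<open>With \<open>i\<close> rotated to the front, its pairing with the rest is
    \<open>be [i] ws\<close> divided by \<open>be [i] [i]\<close>.\<close>
  have letter: "inL ws" if i: "i \<in> set ws" and be: "be [i] ws \<noteq> be [i] [i]" for i
  proof -
    obtain a b where ws: "ws = a @ [i] @ b"
      using i by (metis append_Cons append_Nil in_set_conv_decomp)
    show ?thesis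
    proof (cases "b @ a = []")
      case True
      then show ?thesis
        by (simp add: ws inL_single)
    next
      case False
      have "be [i] ws = be [i] [i] * be [i] (b @ a)"
        by (simp only: ws be_append ac_simps)
      then have "be [i] (b @ a) \<noteq> 1"
        using be by auto
      then have "inL ([i] @ (b @ a))"
        using False by (intro split) (simp_all add: ws)
      then show ?thesis
        using rot[of "[i] @ b" a] unfolding ws by simp
    qed
  qed
  consider "False \<notin> set ws" | "True \<notin> set ws" | "False \<in> set ws" "True \<in> set ws" "be [False] ws \<noteq> q ^ 2"
    | "False \<in> set ws" "True \<in> set ws" "be [True] ws \<noteq> q ^ 6"
    | "False \<in> set ws" "True \<in> set ws" "be [False] ws = q ^ 2" "be [True] ws = q ^ 6"
    by blast
  then show ?case
  proof cases
    case 1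
    then have "ws = replicate (length ws) True"
      by (metis (full_types) replicate_eqI)
    then show ?thesis
      using inL_pure less.prems by (metis length_greater_0_conv)
  next
    case 2
    then have "ws = replicate (length ws) False"
      by (metis (full_types) replicate_eqI)
    then show ?thesis
      using inL_pure less.prems by (metis length_greater_0_conv)
  next
    case 3
    then show ?thesis
      using letter be_single by simp
  next
    case 4
    then show ?thesis
      using letter be_single by simp
  next
    case 5
    obtain a b c where ws: "ws = a @ b" and ba: "b @ a = [False, True] @ c"
      using rotate_to_False_True[OF 5(1,2)] by blast
    have len: "length ([False, True] @ c) = length ws"
      unfolding ba[symmetric] ws by simp
    have be_ws: "be d ([False, True] @ c) = be d ws" for d
      unfolding ba[symmetric] ws be_append by (rule mult.commute)
    \<comment> \<open>The two conditions of this case multiply. Since \<open>[False, True]\<close>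
      pairs with itself to \<open>q ^ 2\<close>, its pairing with the remaining word is
      \<open>q ^ 6\<close>.\<close>
    have FT: "be [False, True] ws = q ^ 8"
      using be_append(1)[of "[False]" "[True]" ws] 5 by (simp flip: power_add)
    have q0: "q \<noteq> 0"
      by (rule nonzero)
    then have q2: "q ^ 2 \<noteq> 0"
      by simp
    \<comment> \<open>The word \<open>[False, True]\<close> alone violates the condition on
      \<open>False\<close>, because \<open>t ^ 3\<close> is not 1.\<close>
    have c: "c \<noteq> []"
    proof
      assume "c = []"
      then have "q ^ 2 = q ^ 2 * t ^ 3"
        using be_ws[of "[False]"] 5(3) be_append(2)[of "[False]" "[False]" "[True]"] by (simp add: be_single)
      then show False
        using t_ne q0 by simp
    qed
    have "q ^ 2 * be [False, True] c = q ^ 2 * q ^ 6"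
      using be_ws[of "[False, True]"] unfolding FT be_append(2) be_FT by (simp flip: power_add)
    then have bc: "be [False, True] c = q ^ 6"
      unfolding mult_left_cancel[OF q2] .
    have "inL ([False, True] @ c)"
    proof (cases "q ^ 6 = 1")
      case False
      then show ?thesis
        using bc c len by (intro split) simp_all
    next
      case True
      have "(q ^ 3) ^ 2 = 1"
        using True by (simp flip: power_mult)
      \<comment> \<open>Now the square of \<open>x2\<close> vanishes, so either the word is zero in
        the quotient or \<open>[False, True]\<close> is followed by \<open>False\<close>.\<close>
      then have "M \<le> 2"
        using M(3)[of 2] by force
      then have x2: "wd [True] ^ 2 \<in> nid"
        using nid_power_ge[OF x2_M] by (simp add: x2_def)
      obtain i c' where c': "c = i # c'"
        using c by (cases c) auto
      show ?thesis
      proof (cases i)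
        case True
        have "wd ([False, True] @ c) = wd [False] * (wd [True] ^ 2 * wd c')"
          by (simp add: c' True wd_Cons[of False "_ # _"] wd_Cons[of True "_ # _"] wd_Cons[of True c']
              power2_eq_square mult.assoc)
        also have "\<dots> \<in> nid"
          by (intro nid_mult_right nid_mult_left x2)
        finally show ?thesis
          by (rule inL_nid)
      next
        case False
        have ws': "[False, True] @ c = [False, True, False] @ c'"
          by (simp add: c' False)
        have "be [False, True, False] ws = be [False, True] ws * be [False] ws"
          using be_append(1)[of "[False, True]" "[False]" ws] by simp
        also have "\<dots> = q ^ 10"
          by (simp add: FT 5 flip: power_add)
        finally have "q ^ 2 * be [False, True, False] c' = q ^ 10"
          using be_ws[of "[False, True, False]"] unfolding ws' be_append(2) be_FTF by simp
        also have "q ^ 10 = q ^ 2 * (q ^ 6 * q ^ 2)"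
          by (simp flip: power_add)
        finally have "be [False, True, False] c' = q ^ 2"
          unfolding mult_left_cancel[OF q2] True by simp
        moreover have "q ^ 2 \<noteq> 1"
          using q_ne by (simp add: power2_eq_1_iff)
        moreover have "c' \<noteq> []"
        proof
          assume "c' = []"
          then have "q ^ 2 = be [False] [False] * be [False] [True] * be [False] [False]"
            using be_ws[of "[False]"] 5(3) unfolding ws' using be_append(2)[of "[False]" "[False, True]" "[False]"]
              be_append(2)[of "[False]" "[False]" "[True]"] by simp
          also have "\<dots> = q ^ 2 * (q ^ 2 * t ^ 3)"
            by (simp add: be_single)
          also have "q ^ 2 * t ^ 3 = t"
            using qt by algebra
          finally show False
            using q0 t_ne by simp
        qed
        ultimately show ?thesis
          unfolding ws' using len unfolding ws' by (intro split) simp_all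
      qed
    qed
    then have "inL (b @ a)"
      unfolding ba .
    then have "inL (a @ b)"
      by (rule rot) (simp add: ws)
    then show ?thesis
      unfolding ws .
  qed
qed

end

section \<open>The dimension\<close>

definition homog :: "nat \<Rightarrow> 'a::field ncser \<Rightarrow> bool" where
  "homog n f \<longleftrightarrow> (\<forall>w. cf f w \<noteq> 0 \<longrightarrow> length w = n)"

lemma homog_simps: "homog (length w) (wd w)" "homog 0 1"
  by (simp_all add: homog_def cf_wd)

lemma homog_diff: "homog n f \<Longrightarrow> homog n g \<Longrightarrow> homog n (f - scl c g)"
  unfolding homog_def by (metis cf_simps(4,6) diff_zero mult_zero_right)

lemma homog_mult:
  assumes "homog m f" "homog n g"
  shows "homog (m + n) (f * g)"
  unfolding homog_def
proof (intro allI impI)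
  fix w
  assume "cf (f * g) w \<noteq> 0"
  then obtain k where k: "k \<le> length w" "cf f (take k w) * cf g (drop k w) \<noteq> 0"
    unfolding cf_mult tmult_def by (metis (no_types, lifting) atMost_iff sum.neutral)
  then have "length (take k w) = m" "length (drop k w) = n"
    using assms unfolding homog_def by (metis mult_zero_left, metis mult_zero_right)
  with k(1) show "length w = m + n"
    by simp
qed

lemma homog_power: "homog m f \<Longrightarrow> homog (n * m) (f ^ n)"
  by (induction n) (simp_all add: homog_simps homog_mult)

context braiding
begin

lemma homog_bev: "homog (length (leaves b)) (bev b)"
proof (induction b)
  case (Gen i)
  then show ?case
    using homog_simps(1)[of "[i]"] by (simp add: bev_simps)
next
  case (Brk s t)
  have "homog (length (leaves s) + length (leaves t)) (bev t * bev s)"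
    using homog_mult[OF Brk(2,1)] by (simp add: add.commute)
  then show ?case
    using homog_diff[OF _ homog_mult[OF Brk(1,2)]] by (simp add: bev_simps)
qed

lemma leaves_nonempty: "leaves b \<noteq> []"
  by (induction b) auto

lemma Phi_span: "g \<in> ncv.span S \<Longrightarrow> Phi g \<in> ncv.span (Phi ` S)"
proof -
  have "ncv.subspace {f. Phi f \<in> ncv.span (Phi ` S)}"
    by (rule ncv.subspaceI) (auto simp: Phi_linear ncv.span_zero ncv.span_add ncv.span_scale)
  moreover have "S \<subseteq> {f. Phi f \<in> ncv.span (Phi ` S)}"
    by (auto intro: ncv.span_base)
  ultimately have "ncv.span S \<subseteq> {f. Phi f \<in> ncv.span (Phi ` S)}"
    by (intro ncv.span_minimal)
  then show "g \<in> ncv.span S \<Longrightarrow> Phi g \<in> ncv.span (Phi ` S)"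
    by blast
qed

lemma Phi_homog_in_span:
  assumes f: "homog n f" and S: "\<And>w. length w = n \<Longrightarrow> Phi (wd w) \<in> ncv.span S"
  shows "Phi f \<in> ncv.span S"
proof -
  have "f = (\<Sum>w | length w = n. scl (cf f w) (wd w))"
    using f unfolding homog_def by (intro ncser_homogeneous_expand) blast
  then have "Phi f = (\<Sum>w | length w = n. scl (cf f w) (Phi (wd w)))"
    by (metis (no_types, lifting) Phi_linear(3) Phi_sum sum.cong)
  also have "\<dots> \<in> ncv.span S"
    by (intro ncv.span_sum ncv.span_scale S) simp
  finally show ?thesis .
qed

text \<open>The exchange lemma squeezes the size of a basis between \<open>W\<close> and
  \<open>U\<close>; a maximal independent set of bracket images is such a basis.\<close>

lemma dim_L_I:
  assumes U: "finite U" "\<And>b. Phi (bev b) \<in> ncv.span U" "card U \<le> k"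
    and W: "ncv.independent W" "W \<subseteq> ncv.span (range (\<lambda>b. Phi (bev b)))" "k \<le> card W"
  shows "dim_L qm k"
proof -
  let ?R = "range (\<lambda>b. Phi (bev b))"
  obtain B0 where B0: "B0 \<subseteq> ?R" "ncv.independent B0" "?R \<subseteq> ncv.span B0"
    using ncv.maximal_independent_subset[of ?R] by blast
  have "B0 \<subseteq> ncv.span U"
    using B0(1) U(2) by blast
  then have fin: "finite B0" "card B0 \<le> card U"
    using ncv.independent_span_bound[OF U(1) B0(2)] by blast+
  have "ncv.span ?R \<subseteq> ncv.span B0"
    using B0(3) ncv.span_minimal ncv.subspace_span by blast
  then have "card W \<le> card B0"
    using ncv.independent_span_bound[OF fin(1) W(1)] W(2) by blast
  then have card: "card B0 = k"
    using fin U(3) W(3) by linarith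
  \<comment> \<open>\<open>dim_L\<close> asks for a set of brackets, not of classes, so one bracket
    is chosen for each basis vector.\<close>
  define h where "h = inv_into UNIV (\<lambda>b. Phi (bev b))"
  have h: "Phi (bev (h x)) = x" if "x \<in> B0" for x
    unfolding h_def using that B0(1) f_inv_into_f[of x "\<lambda>b. Phi (bev b)" UNIV] by blast
  then have inj: "inj_on h B0"
    by (metis inj_onI)
  have sum_h: "Phi (\<Sum>t\<in>h ` B0. scl (c t) (bev t)) = (\<Sum>x\<in>B0. scl (c (h x)) x)" for c
    by (simp add: Phi_sum Phi_linear sum.reindex[OF inj] h cong: sum.cong)
  have cf_sum: "(\<lambda>w. \<Sum>t\<in>B. c t * brk_eval qm t w) = cf (\<Sum>t\<in>B. scl (c t) (bev t))" for c B
    by (rule ext) (simp add: bev_def)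
  show ?thesis
    unfolding dim_L_def
  proof (intro exI[of _ "h ` B0"] conjI allI impI ballI)
    show "finite (h ` B0)" "card (h ` B0) = k"
      using fin card inj by (simp_all add: card_image)
  next
    fix c t
    assume "nichols_ideal qm (\<lambda>w. \<Sum>t\<in>h ` B0. c t * brk_eval qm t w)" and t: "t \<in> h ` B0"
    then have "(\<Sum>t\<in>h ` B0. scl (c t) (bev t)) \<in> nid"
      unfolding cf_sum nid_def by simp
    then have "(\<Sum>x\<in>B0. scl (c (h x)) x) = 0"
      unfolding sum_h[symmetric] Phi_0_iff .
    then have "c (h x) = 0" if "x \<in> B0" for x
      using ncv.independentD[OF B0(2) fin(1) subset_refl, of "\<lambda>x. c (h x)" x] that by blast
    then show "c t = 0"
      using t by blast
  next
    fix s
    have "Phi (bev s) \<in> ncv.span B0"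
      using B0(3) by blast
    then obtain g where g: "Phi (bev s) = (\<Sum>x\<in>B0. scl (g x) x)"
      unfolding ncv.span_finite[OF fin(1)] by blast
    define c where "c t = g (Phi (bev t))" for t
    have "Phi (\<Sum>t\<in>h ` B0. scl (c t) (bev t)) = Phi (bev s)"
      unfolding sum_h g by (intro sum.cong) (simp_all add: c_def h)
    then have "bev s - (\<Sum>t\<in>h ` B0. scl (c t) (bev t)) \<in> nid"
      by (simp add: Phi_eq_iff[symmetric])
    moreover have "(\<lambda>w. brk_eval qm s w - (\<Sum>t\<in>h ` B0. c t * brk_eval qm t w))
        = cf (bev s - (\<Sum>t\<in>h ` B0. scl (c t) (bev t)))"
      by (rule ext) (simp add: bev_def)
    ultimately have "nichols_ideal qm (\<lambda>w. brk_eval qm s w - (\<Sum>t\<in>h ` B0. c t * brk_eval qm t w))"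
      by (simp add: nid_def)
    then show "\<exists>c. nichols_ideal qm (\<lambda>w. brk_eval qm s w - (\<Sum>t\<in>h ` B0. c t * brk_eval qm t w))"
      by (rule exI[of _ c])
  qed
qed

end

context braiding_G2_order
begin

lemma finite_exps: "finite exps"
  and card_exps: "card exps = M ^ 3 * N ^ 3"
  by (simp_all add: exps_def card_cartesian_product power3_eq_cube)

lemma zero_in_exps: "(0, 0, 0, 0, 0, 0) \<in> exps"
  by (simp add: exps_def N M)

lemma wd_in_span_bev:
  assumes "ws \<noteq> []"
  shows "Phi (wd ws) \<in> ncv.span (range (\<lambda>b. Phi (bev b)))"
proof -
  obtain g where g: "g \<in> ncv.span (bev ` {b. deg (leaves b) = deg ws})" "wd ws - g \<in> nid"
    using inL_nonempty[OF assms] unfolding inL_def brkmod_def brkspan_def by blast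
  have "Phi g \<in> ncv.span (Phi ` (bev ` {b. deg (leaves b) = deg ws}))"
    using g(1) by (rule Phi_span)
  moreover have "Phi ` (bev ` {b. deg (leaves b) = deg ws}) \<subseteq> range (\<lambda>b. Phi (bev b))"
    by blast
  ultimately have "Phi g \<in> ncv.span (range (\<lambda>b. Phi (bev b)))"
    using ncv.span_mono by blast
  then show ?thesis
    using g(2) by (simp add: Phi_eq_iff[symmetric])
qed

lemma homog_root_vectors: "homog 1 x1" "homog 1 x2" "homog 2 z" "homog 3 v" "homog 4 u" "homog 5 w"
proof -
  show x: "homog 1 x1" "homog 1 x2"
    using homog_simps(1)[of "[False]"] homog_simps(1)[of "[True]"] by (simp_all add: x1_def x2_def)
  have *: "homog k (f * g - scl c (g * f))" if "homog m f" "homog n g" "k = m + n" for k m n f g and c :: 'a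
    using that homog_diff[OF homog_mult[OF that(1,2)]] homog_mult[OF that(2,1)] by (simp add: add.commute)
  show z: "homog 2 z"
    unfolding z_def by (rule *[OF x(2,1)]) simp
  show v: "homog 3 v"
    unfolding v_def by (rule *[OF z x(1)]) simp
  show "homog 4 u"
    unfolding u_def by (rule *[OF v x(1)]) simp
  show "homog 5 w"
    unfolding w_def by (rule *[OF v z]) simp
qed

lemma homog_pbw: "homog (f * 1 + e * 4 + d * 3 + c * 5 + b * 2 + a * 1) (pbw (a, b, c, d, e, f))"
  unfolding pbw_def prod.case
  by (intro homog_mult homog_power homog_root_vectors)

lemma Phi_pbw_inj: "inj_on (\<lambda>x. Phi (pbw x)) exps"
proof (rule inj_onI, rule ccontr)
  fix x y
  assume xy: "x \<in> exps" "y \<in> exps" "Phi (pbw x) = Phi (pbw y)" "x \<noteq> y"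
  define C where "C a = (if a = x then 1 else if a = y then - 1 else 0 :: 'a)" for a
  have "(\<Sum>a\<in>exps. scl (C a) (pbw a)) = (\<Sum>a\<in>{x, y}. scl (C a) (pbw a))"
    using xy finite_exps by (intro sum.mono_neutral_right) (auto simp: C_def)
  also have "\<dots> = pbw x - pbw y"
    using xy(4) by (auto intro!: ncser_eqI simp: C_def)
  also have "\<dots> \<in> nid"
    using xy(3) by (simp add: Phi_eq_iff)
  finally have "C x = 0"
    using pbw_independent xy(1) by blast
  then show False
    by (simp add: C_def)
qed

lemma Phi_pbw_independent: "ncv.independent ((\<lambda>x. Phi (pbw x)) ` exps)"
proof (rule ncv.independent_if_scalars_zero)
  fix f y
  assume sum: "(\<Sum>y\<in>(\<lambda>x. Phi (pbw x)) ` exps. scl (f y) y) = 0"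
    and "y \<in> (\<lambda>x. Phi (pbw x)) ` exps"
  then obtain x where x: "x \<in> exps" "y = Phi (pbw x)"
    by blast
  have "Phi (\<Sum>x\<in>exps. scl (f (Phi (pbw x))) (pbw x)) = 0"
    using sum by (simp add: sum.reindex[OF Phi_pbw_inj] Phi_sum Phi_linear)
  then have "(\<Sum>x\<in>exps. scl (f (Phi (pbw x))) (pbw x)) \<in> nid"
    by (simp add: Phi_0_iff)
  from pbw_independent[OF this x(1)] show "f y = 0"
    by (simp add: x(2))
qed (simp add: finite_exps)

text \<open>Normal words bound the dimension from above, PBW monomials from below. Both families
  omit the unit: brackets have positive length, and rewriting preserves length, so the empty word
  never arises.\<close>

lemma dim_L_G2: "dim_L qm (M ^ 3 * N ^ 3 - 1)"
proof (rule dim_L_I)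
  let ?o = "(0, 0, 0, 0, 0, 0) :: nat \<times> nat \<times> nat \<times> nat \<times> nat \<times> nat"
  have card_o: "card (exps - {?o}) = M ^ 3 * N ^ 3 - 1"
    using zero_in_exps finite_exps by (simp add: card_exps)
  let ?U = "(\<lambda>ws. Phi (wd ws)) ` (nrm - {[]})"
  have fin: "finite nrm"
    unfolding nrm_def by (intro finite_imageI finite_exps)
  then show "finite ?U"
    by simp
  show "Phi (bev b) \<in> ncv.span ?U" for b
  proof (rule Phi_homog_in_span[OF homog_bev])
    fix ws :: "bool list"
    assume len: "length ws = length (leaves b)"
    have "Phi (wd ws) \<in> ncv.span ((\<lambda>w. Phi (wd w)) ` {u. u \<in> nrm \<and> length u = length ws})"
      using reducible by (rule Phi_wd_in_span_normal)
    moreover have "{u. u \<in> nrm \<and> length u = length ws} \<subseteq> nrm - {[]}"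
      using len leaves_nonempty[of b] by auto
    ultimately show "Phi (wd ws) \<in> ncv.span ?U"
      by (meson image_mono ncv.span_mono subsetD)
  qed
  have "nrm - {[]} \<subseteq> (\<lambda>(a, b, c, d, e, f). npw a b c d e f) ` (exps - {?o})"
  proof
    fix ws
    assume "ws \<in> nrm - {[]}"
    then obtain x where x: "x \<in> exps" "ws = (\<lambda>(a, b, c, d, e, f). npw a b c d e f) x" "ws \<noteq> []"
      unfolding nrm_def by blast
    then have "x \<noteq> ?o"
      by (auto simp: npw_def)
    with x show "ws \<in> (\<lambda>(a, b, c, d, e, f). npw a b c d e f) ` (exps - {?o})"
      by blast
  qed
  then have "card (nrm - {[]}) \<le> card (exps - {?o})"
    by (intro surj_card_le) (simp_all add: finite_exps)
  then show "card ?U \<le> M ^ 3 * N ^ 3 - 1"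
    unfolding card_o using card_image_le[of "nrm - {[]}" "\<lambda>ws. Phi (wd ws)"] fin by simp
  let ?W = "(\<lambda>x. Phi (pbw x)) ` (exps - {?o})"
  show "ncv.independent ?W"
    using Phi_pbw_independent by (rule ncv.independent_mono) blast
  show "?W \<subseteq> ncv.span (range (\<lambda>b. Phi (bev b)))"
  proof (rule image_subsetI)
    fix x
    assume "x \<in> exps - {?o}"
    moreover obtain a b c d e f where x: "x = (a, b, c, d, e, f)"
      by (cases x)
    ultimately have "f * 1 + e * 4 + d * 3 + c * 5 + b * 2 + a * 1 \<noteq> 0"
      by auto
    then show "Phi (pbw x) \<in> ncv.span (range (\<lambda>b. Phi (bev b)))"
      unfolding x by (intro Phi_homog_in_span[OF homog_pbw] wd_in_span_bev) auto
  qed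
  have "inj_on (\<lambda>x. Phi (pbw x)) (exps - {?o})"
    using Phi_pbw_inj by (rule inj_on_subset) blast
  then show "M ^ 3 * N ^ 3 - 1 \<le> card ?W"
    using card_o by (simp add: card_image)
qed

end

lemma root_of_unity_dvd:
  fixes q :: "'a::field"
  assumes "0 < N" "q ^ N = 1" "\<forall>k. 0 < k \<and> k < N \<longrightarrow> q ^ k \<noteq> 1" "q ^ m = 1"
  shows "N dvd m"
proof -
  have "q ^ m = (q ^ N) ^ (m div N) * q ^ (m mod N)"
    by (simp flip: power_mult power_add)
  then have "q ^ (m mod N) = 1"
    using assms by simp
  moreover have "m mod N < N"
    using assms(1) by simp
  ultimately have "m mod N = 0"
    using assms(3) by (metis gr0I)
  then show ?thesis
    by (simp add: dvd_eq_mod_eq_0)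
qed

theorem theorem4p3:
  fixes q :: "'a::field_char_0" and qm :: "bool \<Rightarrow> bool \<Rightarrow> 'a" and N :: nat
  assumes "alg_closed_field TYPE('a)"
    and "N > 0" and "q ^ N = 1" and "\<forall>k. 0 < k \<and> k < N \<longrightarrow> q ^ k \<noteq> 1"
    and "q \<noteq> 1" and "q \<noteq> -1" and "q ^ 3 \<noteq> 1"
    and "qm False False = q"
    and "qm False True * qm True False = inverse (q ^ 3)"
    and "qm True True = q ^ 3"
  shows "(\<not> 3 dvd N \<longrightarrow> dim_L qm (N ^ 6 - 1))
       \<and> (3 dvd N \<longrightarrow> dim_L qm ((N div 3) ^ 3 * N ^ 3 - 1))"
proof -
  have q0: "q \<noteq> 0"
    using assms(2,3) by (metis power_0_left less_irrefl zero_neq_one)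
  then have r0: "qm True False \<noteq> 0"
    using assms(9) by auto
  have order: "N dvd m" if "q ^ m = 1" for m
    using root_of_unity_dvd[OF assms(2-4) that] .
  have dim: "dim_L qm (M ^ 3 * N ^ 3 - 1)"
    if M: "0 < M" "(q ^ 3) ^ M = 1" "\<And>k. 0 < k \<Longrightarrow> k < M \<Longrightarrow> (q ^ 3) ^ k \<noteq> 1" for M
  proof -
    \<comment> \<open>The free unit \<open>r\<close> is \<open>qm True False\<close>; the Cartan
      condition then determines \<open>qm False True\<close>.\<close>
    interpret braiding_G2_order qm q "inverse q" "qm True False" "inverse (qm True False)" N M
    proof
      have "qm False True = (qm False True * qm True False) * inverse (qm True False)"
        using r0 by simp
      then show "qm False True = inverse q ^ 3 * inverse (qm True False)"
        unfolding assms(9) by (simp only: power_inverse)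
    qed (use assms(2-8,10) q0 r0 M in auto)
    show ?thesis
      by (rule dim_L_G2)
  qed
  show ?thesis
  proof (intro conjI impI)
    assume "\<not> 3 dvd N"
    then have cop: "coprime N 3"
      using prime_imp_coprime[of 3 N] by (simp add: coprime_commute)
    \<comment> \<open>Cubing preserves an order prime to 3, so here \<open>M\<close> is
      \<open>N\<close>.\<close>
    have "(q ^ 3) ^ k \<noteq> 1" if "0 < k" "k < N" for k
    proof
      assume "(q ^ 3) ^ k = 1"
      then have "N dvd 3 * k"
        by (intro order) (simp add: power_mult)
      then have "N dvd k"
        using cop coprime_dvd_mult_right_iff by blast
      with that show False
        using nat_dvd_not_less by blast
    qed
    moreover have "(q ^ 3) ^ N = 1"
      using assms(3) by (metis power_mult power_one mult.commute)
    ultimately have "dim_L qm (N ^ 3 * N ^ 3 - 1)"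
      using assms(2) by (intro dim)
    then show "dim_L qm (N ^ 6 - 1)"
      by (simp flip: power_add)
  next
    assume "3 dvd N"
    then have N: "N = 3 * (N div 3)"
      by simp
    \<comment> \<open>Here cubing divides the order by 3, so \<open>M\<close> is
      \<open>N div 3\<close>.\<close>
    have "(q ^ 3) ^ k \<noteq> 1" if "0 < k" "k < N div 3" for k
    proof
      assume "(q ^ 3) ^ k = 1"
      then have "N dvd 3 * k"
        by (intro order) (simp add: power_mult)
      then have "N \<le> 3 * k"
        using that by (intro dvd_imp_le) auto
      with that show False
        by linarith
    qed
    moreover have "(q ^ 3) ^ (N div 3) = 1"
      using assms(3) N by (metis power_mult)
    moreover have "0 < N div 3"
      using assms(2) N by (metis gr0I mult_0_right less_irrefl)
    ultimately show "dim_L qm ((N div 3) ^ 3 * N ^ 3 - 1)"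
      by (intro dim)
  qed
qed

end
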